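(* Let $z=x+iy\in\mathcal D$ and $k\ge4$ even. Each of the following holds. \begin{enumerate} \item[(i)] Uniformly, for any $A\ge1$, $$R_k(z,z)\ll_A\begin{cases}1+\frac{y}{\sqrt k}&\text{if }\min_{n\in\mathbb Z}\big|n-\frac{k-1}{4\pi y}\big|\le\frac{\sqrt k\log k}{y},\\ k^{-A}&\text{otherwise.}\end{cases}$$ \item[(ii)] If $y\ge k/(2\pi)$ then $R_k(z,z)\ll e^{-k/37}$. \item[(iii)] For $k$ sufficiently large, $$R_k(z,z)\gg\begin{cases}1&\text{if }2\le y\le\frac{\sqrt k}{12\pi},\\ \frac{y}{\sqrt k}&\text{if }\frac{\sqrt k}{12\pi}<y<\frac{k}{2\pi}\text{ and }\min_{n\in\mathbb N}\big|\frac{k-1}{4\pi y}-n\big|\le\frac{\sqrt{k-1}}{12\pi y}.\end{cases}$$ \end{enumerate}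
   Context: $\mathbb H^2=\{z=x+iy:\ y>0\}$, $\mathcal D=\{z\in\mathbb H^2:\ |\Re z|\le1/2,\ |z|\ge1\}$. For $\gamma=\begin{pmatrix}a&b\\c&d\end{pmatrix}\in\mathrm{SL}_2(\mathbb Z)$ acting by $\gamma z=\frac{az+b}{cz+d}$ and $z,w\in\mathbb H^2$, set $b_\gamma(z,w)=\frac{2i}{w+\gamma z}\cdot\frac{1}{cz+d}$. For $z=x+iy$, $w=u+iv\in\mathbb H^2$ and even $k\ge4$, define $R_k(z,w)=(yv)^{k/2}\sum_{\gamma\in\mathrm{SL}_2(\mathbb Z)}b_\gamma(z,-\overline w)^k$. *)

theory Defs
  imports "HOL-Analysis.Analysis"
begin

definition upper_half_plane :: "complex set" where
  "upper_half_plane = {z. Im z > 0}"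

definition fund_domain :: "complex set" where
  "fund_domain = {z \<in> upper_half_plane. \<bar>Re z\<bar> \<le> 1/2 \<and> norm z \<ge> 1}"

definition SL2Z :: "(int^2^2) set" where
  "SL2Z = {\<gamma>. det \<gamma> = 1}"

definition moebius_den :: "int^2^2 \<Rightarrow> complex \<Rightarrow> complex" where
  "moebius_den \<gamma> z = of_int (\<gamma> $ 2 $ 1) * z + of_int (\<gamma> $ 2 $ 2)"

definition moebius_act :: "int^2^2 \<Rightarrow> complex \<Rightarrow> complex" where
  "moebius_act \<gamma> z =
     (of_int (\<gamma> $ 1 $ 1) * z + of_int (\<gamma> $ 1 $ 2)) / moebius_den \<gamma> z"

definition b_fun :: "int^2^2 \<Rightarrow> complex \<Rightarrow> complex \<Rightarrow> complex" where
  "b_fun \<gamma> z w = 2 * \<i> / (w + moebius_act \<gamma> z) * (1 / moebius_den \<gamma> z)"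

text \<open>Only used for even \<open>k \<ge> 4\<close>: the exponent \<open>k div 2\<close> is then exactly \<open>k/2\<close>, and the
  series converges absolutely, so that the unordered sum is the intended one.\<close>

definition R_ker :: "nat \<Rightarrow> complex \<Rightarrow> complex \<Rightarrow> complex" where
  "R_ker k z w =
     of_real ((Im z * Im w) ^ (k div 2)) * (\<Sum>\<^sub>\<infinity>\<gamma>\<in>SL2Z. b_fun \<gamma> z (- cnj w) ^ k)"

text \<open>On the diagonal the kernel is real, because complex conjugation exchanges the terms of
  \<open>\<gamma>\<close> and its inverse. Lower bounds for \<open>R_ker k z z\<close> can hence be stated for its real part.\<close>

definition adj2 :: "int^2^2 \<Rightarrow> int^2^2" where
  "adj2 \<gamma> = vector [vector [\<gamma> $ 2 $ 2, - (\<gamma> $ 1 $ 2)], vector [- (\<gamma> $ 2 $ 1), \<gamma> $ 1 $ 1]]"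

lemma adj2_nth [simp]:
  "adj2 \<gamma> $ 1 $ 1 = \<gamma> $ 2 $ 2" "adj2 \<gamma> $ 1 $ 2 = - (\<gamma> $ 1 $ 2)"
  "adj2 \<gamma> $ 2 $ 1 = - (\<gamma> $ 2 $ 1)" "adj2 \<gamma> $ 2 $ 2 = \<gamma> $ 1 $ 1"
  by (simp_all add: adj2_def)

lemma adj2_adj2 [simp]: "adj2 (adj2 \<gamma>) = \<gamma>"
  by (simp add: vec_eq_iff forall_2)

lemma adj2_SL2Z: "\<gamma> \<in> SL2Z \<Longrightarrow> adj2 \<gamma> \<in> SL2Z"
  by (simp add: SL2Z_def det_2 algebra_simps)

lemma bij_betw_adj2: "bij_betw adj2 SL2Z SL2Z"
  by (rule bij_betwI[where g = adj2]) (auto simp: adj2_SL2Z)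

lemma moebius_den_nonzero:
  assumes "\<gamma> \<in> SL2Z" "Im z > 0"
  shows "moebius_den \<gamma> z \<noteq> 0"
proof
  assume *: "moebius_den \<gamma> z = 0"
  have "real_of_int (\<gamma> $ 2 $ 1) * Im z = 0"
    using arg_cong[OF *, of Im] by (simp add: moebius_den_def)
  hence c: "\<gamma> $ 2 $ 1 = 0" using assms by simp
  hence "\<gamma> $ 2 $ 2 = 0" using * by (simp add: moebius_den_def)
  thus False using c assms by (simp add: SL2Z_def det_2)
qed

lemma b_fun_diag:
  assumes "\<gamma> \<in> SL2Z" "Im z > 0"
  shows "b_fun \<gamma> z (- cnj z) = 2 * \<i> /
    (of_int (\<gamma> $ 1 $ 1) * z + of_int (\<gamma> $ 1 $ 2) - of_int (\<gamma> $ 2 $ 1) * (z * cnj z)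
      - of_int (\<gamma> $ 2 $ 2) * cnj z)"
proof -
  have "(- cnj z + moebius_act \<gamma> z) * moebius_den \<gamma> z =
      of_int (\<gamma> $ 1 $ 1) * z + of_int (\<gamma> $ 1 $ 2) - cnj z * moebius_den \<gamma> z"
    using moebius_den_nonzero[OF assms] by (simp add: moebius_act_def field_simps)
  also have "\<dots> = of_int (\<gamma> $ 1 $ 1) * z + of_int (\<gamma> $ 1 $ 2)
      - of_int (\<gamma> $ 2 $ 1) * (z * cnj z) - of_int (\<gamma> $ 2 $ 2) * cnj z"
    by (simp add: moebius_den_def algebra_simps)
  finally show ?thesis by (simp add: b_fun_def)
qed

lemma cnj_b_fun_diag:
  assumes "\<gamma> \<in> SL2Z" "Im z > 0"
  shows "cnj (b_fun \<gamma> z (- cnj z)) = b_fun (adj2 \<gamma>) z (- cnj z)"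
proof -
  define D where "D = of_int (\<gamma> $ 1 $ 1) * z + of_int (\<gamma> $ 1 $ 2)
      - of_int (\<gamma> $ 2 $ 1) * (z * cnj z) - of_int (\<gamma> $ 2 $ 2) * cnj z"
  have "b_fun (adj2 \<gamma>) z (- cnj z) = 2 * \<i> / (- cnj D)"
    unfolding b_fun_diag[OF adj2_SL2Z[OF assms(1)] assms(2)]
    by (rule arg_cong[where f = "\<lambda>t. 2 * \<i> / t"]) (simp add: D_def algebra_simps)
  moreover have "b_fun \<gamma> z (- cnj z) = 2 * \<i> / D"
    unfolding b_fun_diag[OF assms] D_def ..
  ultimately show ?thesis by simp
qed

lemma R_ker_diag_real:
  assumes "z \<in> upper_half_plane"
  shows "R_ker k z z \<in> \<real>"
proof -
  have z: "Im z > 0" using assms by (simp add: upper_half_plane_def)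
  have "cnj (\<Sum>\<^sub>\<infinity>\<gamma>\<in>SL2Z. b_fun \<gamma> z (- cnj z) ^ k) =
      (\<Sum>\<^sub>\<infinity>\<gamma>\<in>SL2Z. cnj (b_fun \<gamma> z (- cnj z)) ^ k)"
    by (simp flip: infsum_cnj)
  also have "\<dots> = (\<Sum>\<^sub>\<infinity>\<gamma>\<in>SL2Z. b_fun (adj2 \<gamma>) z (- cnj z) ^ k)"
    by (intro infsum_cong) (simp add: cnj_b_fun_diag z)
  also have "\<dots> = (\<Sum>\<^sub>\<infinity>\<gamma>\<in>SL2Z. b_fun \<gamma> z (- cnj z) ^ k)"
    by (rule infsum_reindex_bij_betw[OF bij_betw_adj2])
  finally show ?thesis by (simp add: R_ker_def Reals_cnj_iff)
qed

end

theory Submission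
  imports Defs
begin

text \<open>
  Split the sum over \<open>SL2Z\<close> by the lower left entry \<open>c\<close>. The terms with \<open>c = 0\<close> give twice
  \<open>\<Sum>n. (1 - i n / (2 y)) ^ (- k)\<close>. Estimated trivially this is \<open>O(1 + y / sqrt k)\<close>; by Lipschitz'
  formula it equals \<open>4 \<pi> y \<Sum>m. g (4 \<pi> y m)\<close>, where \<open>g t = t ^ (k - 1) exp (- t) / (k - 1)!\<close> is
  the density of a Gamma distribution, concentrated in a window of width \<open>sqrt k\<close> around \<open>k - 1\<close>.
  All sharper bounds are read off from whether a multiple of \<open>4 \<pi> y\<close> falls into that window.
  The terms with \<open>c \<noteq> 0\<close> contribute \<open>O(1)\<close>, and \<open>O((4 / 5) ^ k)\<close> if \<open>y \<ge> 2\<close>.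
\<close>

section \<open>Lipschitz' formula\<close>

text \<open>The terms of the sum over \<open>n\<close> have modulus
  \<open>(1 + n^2 / (4 y^2)) ^ (- k / 2)\<close> but varying arguments, so that side serves for an
  upper bound only. On the other side of Lipschitz' formula all terms are nonnegative, so a few of
  them already bound the sum from below. That side is also a Riemann sum of mesh
  \<open>4 * pi * y\<close> for an integral equal to 1: it has size about 1 while the mesh is below
  \<open>sqrt k\<close>, and beyond that it has peaks of height about \<open>y / sqrt k\<close>.

  The obstacle is the region near \<open>y = 1\<close>: at \<open>z = \<i>\<close> the matrices of
  order 4 that fix \<open>\<i>\<close> have \<open>c \<noteq> 0\<close> and contribute terms of
  modulus 1 for every \<open>k\<close>, so no decay can be expected there. The bounds claiming decay
  survive because the gap condition of the first bound forces \<open>y > 2 * sqrt k * ln k\<close>,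
  and because \<open>y \<ge> k / (2 * pi)\<close> together with \<open>y < 2\<close> leaves only
  small \<open>k\<close>, which a constant absorbs.\<close>

lemma summable_power_mult_powser:
  fixes q :: complex
  assumes "norm q < 1"
  shows "summable (\<lambda>m. of_nat m ^ n * q ^ m)"
  using assms
proof (induction n arbitrary: q)
  case 0
  then show ?case by (simp add: summable_geometric)
next
  case (Suc n)
  \<comment> \<open>Termwise differentiation followed by multiplication by \<open>q\<close> raises
    the exponent of \<open>m\<close> by one. It needs convergence on the whole disc, hence the
    induction for arbitrary \<open>q\<close>.\<close>
  have "summable (\<lambda>m. diffs (\<lambda>m. of_nat m ^ n) m * q ^ m)"
    by (rule termdiff_converges[OF Suc.prems]) (rule Suc.IH)
  hence "summable (\<lambda>m. q * (diffs (\<lambda>m. of_nat m ^ n) m * q ^ m))"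
    by (rule summable_mult)
  hence "summable (\<lambda>m. of_nat (Suc m) ^ Suc n * q ^ Suc m)"
    by (simp add: diffs_def mult_ac)
  thus ?case by (subst (asm) summable_Suc_iff)
qed

lemma exp_power_series_has_field_derivative:
  fixes z :: complex
  assumes "Im z > 0"
  defines "a \<equiv> 2 * of_real pi * \<i>"
  shows "((\<lambda>z. \<Sum>m. of_nat m ^ n * exp (a * z) ^ m) has_field_derivative
           a * (\<Sum>m. of_nat m ^ Suc n * exp (a * z) ^ m)) (at z)"
proof -
  define q where "q = exp (a * z)"
  have q: "norm q < 1" using assms by (simp add: q_def)
  let ?c = "\<lambda>m. of_nat m ^ n :: complex"
  have "((\<lambda>q. \<Sum>m. ?c m * q ^ m) has_field_derivative (\<Sum>m. diffs ?c m * q ^ m)) (at q)"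
    by (rule termdiffs_strong'[where K = 1])
       (use q in \<open>auto intro: summable_power_mult_powser\<close>)
  moreover have "((\<lambda>z. exp (a * z)) has_field_derivative a * q) (at z)"
    unfolding q_def by (auto intro!: derivative_eq_intros)
  ultimately have "((\<lambda>z. \<Sum>m. ?c m * exp (a * z) ^ m) has_field_derivative
      (\<Sum>m. diffs ?c m * q ^ m) * (a * q)) (at z)"
    unfolding q_def by (rule DERIV_chain2)
  moreover have "(\<Sum>m. diffs ?c m * q ^ m) * q = (\<Sum>m. of_nat m ^ Suc n * q ^ m)"
  proof -
    have "summable (\<lambda>m. diffs ?c m * q ^ m)"
      by (rule termdiff_converges[OF q]) (rule summable_power_mult_powser)
    hence "(\<Sum>m. diffs ?c m * q ^ m) * q = (\<Sum>m. of_nat (Suc m) ^ Suc n * q ^ Suc m)"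
      by (subst suminf_mult2) (auto simp: diffs_def mult_ac)
    also have "\<dots> = (\<Sum>m. of_nat m ^ Suc n * q ^ m)"
      using suminf_split_head[OF summable_power_mult_powser[OF q, of "Suc n"]] by simp
    finally show ?thesis .
  qed
  ultimately show ?thesis by (simp add: q_def mult_ac)
qed

lemma Im_pos_not_nonpos_Int: "Im z > 0 \<Longrightarrow> z \<notin> \<int>\<^sub>\<le>\<^sub>0" "Im z > 0 \<Longrightarrow> 1 - z \<notin> \<int>\<^sub>\<le>\<^sub>0"
  by (auto elim!: nonpos_Ints_cases simp: complex_eq_iff)

text \<open>
  This is \<open>\<pi> cot (\<pi> z)\<close>, the logarithmic derivative of the reflection formula, expanded in
  \<open>q = exp (2 \<pi> i z)\<close>; its derivatives yield Lipschitz' formula.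
\<close>

lemma Digamma_reflection_exp:
  fixes z :: complex
  assumes z: "Im z > 0"
  shows "Digamma (1 - z) - Digamma z =
           of_real pi * \<i> - 2 * of_real pi * \<i> * (\<Sum>m. exp (2 * of_real pi * \<i> * z) ^ m)"
proof -
  define w where "w = of_real pi * z"
  define q where "q = exp (2 * of_real pi * \<i> * z)"
  have q: "norm q < 1" using assms by (simp add: q_def)
  have q': "q = exp (\<i> * w) ^ 2" by (simp add: q_def w_def mult_ac flip: exp_of_nat_mult)
  have "((\<lambda>z. rGamma z * rGamma (1 - z)) has_field_derivative
      rGamma z * rGamma (1 - z) * (Digamma (1 - z) - Digamma z)) (at z)"
    using Im_pos_not_nonpos_Int[OF z]
    by (auto intro!: derivative_eq_intros simp: algebra_simps)
  moreover have "((\<lambda>z. rGamma z * rGamma (1 - z)) has_field_derivative cos w) (at z)"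
    unfolding rGamma_reflection_complex w_def
    by (auto intro!: derivative_eq_intros)
  ultimately have "rGamma z * rGamma (1 - z) * (Digamma (1 - z) - Digamma z) = cos w"
    by (rule DERIV_unique)
  hence *: "sin w * (Digamma (1 - z) - Digamma z) = of_real pi * cos w"
    by (simp add: rGamma_reflection_complex w_def field_simps)
  have e: "exp (\<i> * w) * exp (- (\<i> * w)) = 1" by (simp flip: exp_add)
  have "exp (\<i> * w) * sin w = \<i> * (1 - q) / 2"
    using e by (simp add: sin_exp_eq q' field_simps power2_eq_square)
  moreover have "exp (\<i> * w) * cos w = (1 + q) / 2"
    using e by (simp add: cos_exp_eq q' field_simps power2_eq_square)
  moreover have "exp (\<i> * w) * sin w * (Digamma (1 - z) - Digamma z) = of_real pi * (exp (\<i> * w) * cos w)"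
    using * by (simp add: mult_ac)
  ultimately have "\<i> * (1 - q) / 2 * (Digamma (1 - z) - Digamma z) = of_real pi * ((1 + q) / 2)"
    by metis
  hence "\<i> * (1 - q) * (Digamma (1 - z) - Digamma z) = of_real pi * (1 + q)"
    by simp
  moreover have "- \<i> * (\<i> * (1 - q) * (Digamma (1 - z) - Digamma z)) = (1 - q) * (Digamma (1 - z) - Digamma z)"
    by (simp flip: mult.assoc)
  ultimately have "(1 - q) * (Digamma (1 - z) - Digamma z) = - \<i> * of_real pi * (1 + q)"
    by (simp add: mult.assoc)
  moreover have "1 - q \<noteq> 0" using q by auto
  ultimately have "Digamma (1 - z) - Digamma z = - \<i> * of_real pi * (1 + q) / (1 - q)"
    by (simp add: field_simps)
  also have "\<dots> = of_real pi * \<i> - 2 * of_real pi * \<i> * (1 / (1 - q))"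
    using \<open>1 - q \<noteq> 0\<close> by (simp add: field_simps)
  finally show ?thesis using q by (simp add: suminf_geometric q_def)
qed

text \<open>Each differentiation multiplies the \<open>m\<close>-th term by \<open>a * m\<close>,
  and the chain rule for \<open>1 - z\<close> flips the sign of the first Polygamma value. The index
  0 is left out because the constant \<open>pi * \<i>\<close> is still present there; the first
  derivative removes it.\<close>

lemma Polygamma_reflection_exp:
  fixes z :: complex
  assumes "n > 0" "Im z > 0"
  defines "a \<equiv> 2 * of_real pi * \<i>"
  shows "(-1) ^ n * Polygamma n (1 - z) - Polygamma n z =
           - (a ^ Suc n) * (\<Sum>m. of_nat m ^ n * exp (a * z) ^ m)"
  using assms(1,2)
proof (induction n arbitrary: z rule: nat_induct_non_zero)
  case 1
  note D = Im_pos_not_nonpos_Int[OF 1]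
  have "((\<lambda>z. Digamma (1 - z) - Digamma z) has_field_derivative
          - Polygamma 1 (1 - z) - Polygamma 1 z) (at z)"
    using D by (auto intro!: derivative_eq_intros)
  \<comment> \<open>Here \<open>0 ^ 0 = 1\<close>, so the sum is the full geometric series including
    its constant term.\<close>
  moreover have "((\<lambda>z. of_real pi * \<i> - a * (\<Sum>m. of_nat m ^ 0 * exp (a * z) ^ m)) has_field_derivative
          - a * (a * (\<Sum>m. of_nat m ^ Suc 0 * exp (a * z) ^ m))) (at z)"
    using exp_power_series_has_field_derivative[OF 1, of 0]
    unfolding a_def by (auto intro!: derivative_eq_intros)
  hence "((\<lambda>z. Digamma (1 - z) - Digamma z) has_field_derivative
          - a * (a * (\<Sum>m. of_nat m ^ Suc 0 * exp (a * z) ^ m))) (at z)"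
    by (rule has_field_derivative_transform_within_open[where S = "{z. Im z > 0}"])
       (use 1 in \<open>auto simp: Digamma_reflection_exp a_def open_halfspace_Im_gt\<close>)
  ultimately have "- Polygamma 1 (1 - z) - Polygamma 1 z =
      - a * (a * (\<Sum>m. of_nat m ^ Suc 0 * exp (a * z) ^ m))" by (rule DERIV_unique)
  then show ?case by (simp add: power2_eq_square mult_ac)
next
  case (Suc n)
  note D = Im_pos_not_nonpos_Int[OF Suc.prems]
  have "((\<lambda>z. (-1) ^ n * Polygamma n (1 - z) - Polygamma n z) has_field_derivative
          (-1) ^ Suc n * Polygamma (Suc n) (1 - z) - Polygamma (Suc n) z) (at z)"
    using D by (auto intro!: derivative_eq_intros)
  moreover have "((\<lambda>z. - (a ^ Suc n) * (\<Sum>m. of_nat m ^ n * exp (a * z) ^ m)) has_field_derivative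
          - (a ^ Suc n) * (a * (\<Sum>m. of_nat m ^ Suc n * exp (a * z) ^ m))) (at z)"
    using exp_power_series_has_field_derivative[OF Suc.prems, of n]
    unfolding a_def by (intro DERIV_cmult)
  hence "((\<lambda>z. (-1) ^ n * Polygamma n (1 - z) - Polygamma n z) has_field_derivative
          - (a ^ Suc n) * (a * (\<Sum>m. of_nat m ^ Suc n * exp (a * z) ^ m))) (at z)"
    by (rule has_field_derivative_transform_within_open[where S = "{z. Im z > 0}"])
       (use Suc in \<open>auto simp: open_halfspace_Im_gt\<close>)
  ultimately show ?case by (auto dest: DERIV_unique simp: mult_ac)
qed

section \<open>Inverse square sums over shifted integers\<close>

text \<open>Comparison with the integral of \<open>1 / (t^2 + Y^2)\<close>, whose primitive is
  \<open>arctan (t / Y) / Y\<close>; the mean value theorem does this term by term. The term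
  \<open>n = 0\<close> is kept apart as \<open>1 / Y ^ 2\<close>.\<close>

lemma sum_nat_inverse_square_add_le:
  fixes Y :: real
  assumes "Y > 0"
  shows "(\<Sum>n<N. 1 / (real n ^ 2 + Y ^ 2)) \<le> 1 / Y ^ 2 + pi / (2 * Y)"
proof -
  have step: "1 / (real (Suc n) ^ 2 + Y ^ 2) \<le> (arctan (real (Suc n) / Y) - arctan (real n / Y)) / Y" for n
  proof -
    have "\<exists>\<xi>>real n. \<xi> < real (Suc n) \<and> arctan (real (Suc n) / Y) - arctan (real n / Y) =
        (real (Suc n) - real n) * (1 / Y / (1 + (\<xi> / Y)\<^sup>2))"
      by (rule MVT2) (use assms in \<open>auto intro!: derivative_eq_intros simp: field_simps\<close>)
    then obtain \<xi> where \<xi>: "\<xi> > real n" "\<xi> < real (Suc n)"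
      "arctan (real (Suc n) / Y) - arctan (real n / Y) = 1 / Y / (1 + (\<xi> / Y)\<^sup>2)" by auto
    have "1 / (real (Suc n) ^ 2 + Y ^ 2) \<le> 1 / (\<xi> ^ 2 + Y ^ 2)"
      using \<xi> assms by (intro divide_left_mono add_mono power_mono mult_pos_pos add_nonneg_pos) auto
    also have "\<xi> ^ 2 + Y ^ 2 = (1 + (\<xi> / Y)\<^sup>2) * Y * Y"
      using assms by (simp add: field_simps power2_eq_square)
    finally show ?thesis using \<xi> by (simp add: mult_ac)
  qed
  have main: "(\<Sum>n<Suc M. 1 / (real n ^ 2 + Y ^ 2)) \<le> 1 / Y ^ 2 + arctan (real M / Y) / Y" for M
  proof (induction M)
    case (Suc M)
    have "(\<Sum>n<Suc (Suc M). 1 / (real n ^ 2 + Y ^ 2)) \<le>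
        1 / Y ^ 2 + arctan (real M / Y) / Y + 1 / (real (Suc M) ^ 2 + Y ^ 2)"
      using Suc by simp
    also have "\<dots> \<le> 1 / Y ^ 2 + arctan (real (Suc M) / Y) / Y"
      using step[of M] by (simp add: diff_divide_distrib)
    finally show ?case .
  qed simp
  have "(\<Sum>n<N. 1 / (real n ^ 2 + Y ^ 2)) \<le> (\<Sum>n<Suc N. 1 / (real n ^ 2 + Y ^ 2))"
    by simp
  also have "\<dots> \<le> 1 / Y ^ 2 + arctan (real N / Y) / Y" by (rule main)
  also have "arctan (real N / Y) / Y \<le> pi / 2 / Y"
    using arctan_ubound assms by (intro divide_right_mono less_imp_le) auto
  finally show ?thesis by (simp add: field_simps)
qed

text \<open>Uniformity in the shift \<open>X\<close> is the point: later \<open>X\<close> is a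
  complicated function of the remaining matrix entries. Cutting where
  \<open>n + \<lfloor>X\<rfloor>\<close> changes sign, each half maps injectively to naturals that
  do not exceed \<open>\<bar>n + X\<bar>\<close>.\<close>

lemma sum_int_inverse_square_add_le:
  fixes X Y :: real and F :: "int set"
  assumes Y: "Y > 0" and F: "finite F"
  shows "(\<Sum>n\<in>F. 1 / ((of_int n + X) ^ 2 + Y ^ 2)) \<le> 2 / Y ^ 2 + pi / Y"
proof -
  define j where "j = \<lfloor>X\<rfloor>"
  define f where "f = (\<lambda>n::nat. 1 / (real n ^ 2 + Y ^ 2))"
  have bound: "(\<Sum>n\<in>G. 1 / ((of_int n + X) ^ 2 + Y ^ 2)) \<le> 1 / Y ^ 2 + pi / (2 * Y)"
    if "finite G" "inj_on h G" "\<And>n. n \<in> G \<Longrightarrow> real (h n) \<le> \<bar>of_int n + X\<bar>"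
    for G :: "int set" and h :: "int \<Rightarrow> nat"
  proof -
    have "(\<Sum>n\<in>G. 1 / ((of_int n + X) ^ 2 + Y ^ 2)) \<le> (\<Sum>n\<in>G. f (h n))"
    proof (rule sum_mono)
      fix n assume "n \<in> G"
      hence "real (h n) ^ 2 \<le> (of_int n + X) ^ 2"
        using that(3)[of n] by (subst power2_abs[symmetric]) (intro power_mono, auto)
      thus "1 / ((of_int n + X) ^ 2 + Y ^ 2) \<le> f (h n)"
        unfolding f_def using Y
        by (intro divide_left_mono add_mono mult_pos_pos add_nonneg_pos) auto
    qed
    also have "\<dots> = sum f (h ` G)" using that by (simp add: sum.reindex)
    also have "\<dots> \<le> sum f {..<Suc (Max (h ` G))}"
      using that by (intro sum_mono2) (auto simp: f_def less_Suc_eq_le)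
    also have "\<dots> \<le> 1 / Y ^ 2 + pi / (2 * Y)"
      unfolding f_def by (rule sum_nat_inverse_square_add_le[OF Y])
    finally show ?thesis .
  qed
  have X: "real_of_int j \<le> X" "X < real_of_int j + 1" unfolding j_def by linarith+
  have "(\<Sum>n\<in>F. 1 / ((of_int n + X) ^ 2 + Y ^ 2)) =
      (\<Sum>n\<in>F \<inter> {n. n + j \<ge> 0}. 1 / ((of_int n + X) ^ 2 + Y ^ 2)) +
      (\<Sum>n\<in>F - {n. n + j \<ge> 0}. 1 / ((of_int n + X) ^ 2 + Y ^ 2))"
    using F by (subst sum.Int_Diff) auto
  also have "\<dots> \<le> (1 / Y ^ 2 + pi / (2 * Y)) + (1 / Y ^ 2 + pi / (2 * Y))"
  proof (rule add_mono)
    show "(\<Sum>n\<in>F \<inter> {n. n + j \<ge> 0}. 1 / ((of_int n + X) ^ 2 + Y ^ 2)) \<le> 1 / Y ^ 2 + pi / (2 * Y)"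
      using F X by (intro bound[where h = "\<lambda>n. nat (n + j)"]) (auto simp: inj_on_def)
    show "(\<Sum>n\<in>F - {n. n + j \<ge> 0}. 1 / ((of_int n + X) ^ 2 + Y ^ 2)) \<le> 1 / Y ^ 2 + pi / (2 * Y)"
    proof (rule bound[where h = "\<lambda>n. nat (- (n + j) - 1)"])
      fix n assume "n \<in> F - {n. n + j \<ge> 0}"
      hence "n + j + 1 \<le> 0" by auto
      hence "real_of_int n + real_of_int j + 1 \<le> 0" by linarith
      thus "real (nat (- (n + j) - 1)) \<le> \<bar>of_int n + X\<bar>" using X \<open>n + j + 1 \<le> 0\<close> by auto
    qed (use F in \<open>auto simp: inj_on_def\<close>)
  qed
  finally show ?thesis by (simp add: field_simps)
qed

lemma norm_of_int_add_sq: "norm (of_int n + w :: complex) ^ 2 = (of_int n + Re w) ^ 2 + Im w ^ 2"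
  by (simp add: cmod_power2)

text \<open>Two of the \<open>n + 1 \<ge> 2\<close> factors give a summable inverse square; each of
  the others is at least \<open>Im w\<close> in modulus.\<close>

lemma abs_summable_inverse_shift_power:
  fixes w :: complex
  assumes "Im w > 0" "n > 0"
  shows "(\<lambda>m::int. norm (1 / (of_int m + w) ^ Suc n)) summable_on UNIV"
proof (rule nonneg_bdd_above_summable_on)
  define C where "C = 1 / Im w ^ (n - 1)"
  have le: "norm (1 / (of_int m + w) ^ Suc n) \<le> C * (1 / ((of_int m + Re w) ^ 2 + Im w ^ 2))" for m :: int
  proof -
    have "Im w \<le> norm (of_int m + w)"
      using abs_Im_le_cmod[of "of_int m + w"] assms by simp
    hence "norm (of_int m + w) ^ 2 * Im w ^ (n - 1) \<le> norm (of_int m + w) ^ 2 * norm (of_int m + w) ^ (n - 1)"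
      using assms by (intro mult_left_mono power_mono) auto
    also have "\<dots> = norm (of_int m + w) ^ Suc n"
      using assms by (simp flip: power_add)
    finally have "1 / norm (of_int m + w) ^ Suc n \<le> 1 / (norm (of_int m + w) ^ 2 * Im w ^ (n - 1))"
      using assms by (intro divide_left_mono mult_pos_pos zero_less_power)
        (auto simp: complex_eq_iff)
    thus ?thesis by (simp add: C_def norm_divide norm_mult norm_power norm_of_int_add_sq mult_ac)
  qed
  have C: "C \<ge> 0" using assms by (simp add: C_def)
  show "bdd_above (sum (\<lambda>m. norm (1 / (of_int m + w) ^ Suc n)) ` {F. F \<subseteq> UNIV \<and> finite F})"
  proof (rule bdd_aboveI2)
    fix F :: "int set" assume "F \<in> {F. F \<subseteq> UNIV \<and> finite F}"
    hence F: "finite F" by simp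
    have "(\<Sum>m\<in>F. norm (1 / (of_int m + w) ^ Suc n)) \<le>
        C * (\<Sum>m\<in>F. 1 / ((of_int m + Re w) ^ 2 + Im w ^ 2))"
      unfolding sum_distrib_left by (intro sum_mono le)
    also have "\<dots> \<le> C * (2 / Im w ^ 2 + pi / Im w)"
      by (intro mult_left_mono C sum_int_inverse_square_add_le assms F)
    finally show "(\<Sum>m\<in>F. norm (1 / (of_int m + w) ^ Suc n)) \<le> C * (2 / Im w ^ 2 + pi / Im w)" .
  qed
qed simp

text \<open>The indices \<open>m \<ge> 0\<close> sum to a Polygamma value at \<open>w\<close> and
  those with \<open>m < 0\<close> to one at \<open>1 - w\<close>; the reflection formula combines
  the two.\<close>

lemma Lipschitz_summation_formula:
  fixes w :: complex
  assumes w: "Im w > 0" and n: "n > 0"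
  defines "a \<equiv> 2 * of_real pi * \<i>"
  shows "(\<Sum>\<^sub>\<infinity>m::int. 1 / (of_int m + w) ^ Suc n) =
           (- a) ^ Suc n / fact n * (\<Sum>m. of_nat m ^ n * exp (a * w) ^ m)"
proof -
  let ?f = "\<lambda>m::int. 1 / (of_int m + w) ^ Suc n"
  have summ: "?f summable_on A" for A
    by (rule summable_on_subset_banach[OF abs_summable_summable[OF
          abs_summable_inverse_shift_power[OF w n]]]) auto
  have pos: "infsum ?f {0..} = (-1) ^ Suc n * Polygamma n w / fact n"
  proof -
    have bij: "bij_betw int UNIV {0..}"
      by (rule bij_betwI[where g = nat]) auto
    have "((\<lambda>m. ?f (int m)) has_sum infsum ?f {0..}) UNIV"
      using summ by (subst has_sum_reindex_bij_betw[OF bij]) auto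
    hence "(\<lambda>m. ?f (int m)) sums infsum ?f {0..}" by (rule has_sum_imp_sums)
    moreover have "(\<lambda>m. ?f (int m)) sums ((-1) ^ Suc n * Polygamma n w / fact n)"
      using Polygamma_LIMSEQ[of w n] Im_pos_not_nonpos_Int(1)[OF w] n
      by (force simp: inverse_eq_divide add.commute)
    ultimately show ?thesis by (rule sums_unique2)
  qed
  have neg: "infsum ?f {..<0} = Polygamma n (1 - w) / fact n"
  proof -
    have bij: "bij_betw (\<lambda>m. - int m - 1) UNIV {..<0}"
      by (rule bij_betwI[where g = "\<lambda>m. nat (- m - 1)"]) auto
    have "((\<lambda>m. ?f (- int m - 1)) has_sum infsum ?f {..<0}) UNIV"
      using summ by (subst has_sum_reindex_bij_betw[OF bij]) auto
    hence "(\<lambda>m. ?f (- int m - 1)) sums infsum ?f {..<0}" by (rule has_sum_imp_sums)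
    moreover have "(\<lambda>m. (-1) ^ Suc n * inverse ((1 - w + of_nat m) ^ Suc n)) sums
        ((-1) ^ Suc n * ((-1) ^ Suc n * Polygamma n (1 - w) / fact n))"
      using Im_pos_not_nonpos_Int(2)[OF w] n by (intro sums_mult Polygamma_LIMSEQ) auto
    moreover have "(-1) ^ Suc n * inverse ((1 - w + of_nat m) ^ Suc n) = ?f (- int m - 1)" for m
    proof -
      have "of_int (- int m - 1) + w = - 1 * (1 - w + of_nat m)" by simp
      hence "?f (- int m - 1) = 1 / ((- 1) ^ Suc n * (1 - w + of_nat m) ^ Suc n)"
        by (metis power_mult_distrib)
      thus ?thesis by (simp add: uminus_power_if inverse_eq_divide)
    qed
    moreover have "(-1) ^ Suc n * ((-1) ^ Suc n * Polygamma n (1 - w) / fact n) = Polygamma n (1 - w) / fact n"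
      by (simp add: uminus_power_if)
    ultimately show ?thesis using sums_unique2 by force
  qed
  have "UNIV = {0..} \<union> {..<0::int}" by auto
  hence "infsum ?f UNIV = infsum ?f {0..} + infsum ?f {..<0}"
    by (metis (no_types) infsum_Un_disjoint[OF summ summ] ivl_disj_int(13) inf_commute
      Int_emptyI atLeast_iff lessThan_iff not_less)
  also have "\<dots> = (-1) ^ n / fact n * ((-1) ^ n * Polygamma n (1 - w) - Polygamma n w)"
    unfolding pos neg by (auto simp: uminus_power_if field_simps)
  also have "\<dots> = (- a) ^ Suc n / fact n * (\<Sum>m. of_nat m ^ n * exp (a * w) ^ m)"
    unfolding a_def Polygamma_reflection_exp[OF n w] by (simp add: uminus_power_if)
  finally show ?thesis .
qed

section \<open>The Gamma density\<close>

text \<open>In logarithms the induction step reads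
  \<open>(x + 1 / 2) * (ln (x + 1) - ln x) \<ge> 1\<close>, which is the midpoint lower bound for
  the integral of \<open>1 / t\<close>. The factor \<open>exp 1\<close> makes \<open>n = 1\<close>
  an equality.\<close>

lemma fact_le_Stirling:
  assumes "n > 0"
  shows "fact n \<le> exp 1 * sqrt (real n) * (real n / exp 1) ^ n"
proof -
  have "ln (fact n) \<le> 1 + ln (real n) / 2 + real n * (ln (real n) - 1)"
    using assms
  proof (induction n rule: nat_induct_non_zero)
    case (Suc n)
    define x where "x = real n"
    have x: "x > 0" using Suc by (simp add: x_def)
    have "ln (x + 1) - ln x \<ge> 2 * (x + 1 - x) / (x + (x + 1))"
      using x by (intro ln_inverse_approx_ge) auto
    hence "(x + 1 / 2) * (ln (x + 1) - ln x) \<ge> (x + 1 / 2) * (2 / (2 * x + 1))"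
      using x by (intro mult_left_mono) (auto simp: algebra_simps)
    also have "(x + 1 / 2) * (2 / (2 * x + 1)) = 1" using x by (simp add: field_simps)
    finally have *: "(x + 1 / 2) * (ln (x + 1) - ln x) \<ge> 1" .
    have "ln (fact (Suc n)) = ln (x + 1) + ln (fact n)"
      by (simp add: ln_mult x_def add_ac)
    also have "\<dots> \<le> ln (x + 1) + (1 + ln x / 2 + x * (ln x - 1))"
      using Suc.IH by (simp add: x_def)
    also have "\<dots> \<le> 1 + ln (x + 1) / 2 + (x + 1) * (ln (x + 1) - 1)"
      using * by (simp add: algebra_simps)
    finally show ?case by (simp add: x_def add_ac)
  qed simp
  also have "\<dots> = ln (exp 1 * sqrt (real n) * (real n / exp 1) ^ n)"
    using assms by (simp add: ln_mult ln_div ln_realpow ln_sqrt)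
  finally show ?thesis using assms by (subst (asm) ln_le_cancel_iff) auto
qed

text \<open>The shape is \<open>N + 1\<close> and the mode is \<open>N\<close>; the application has
  \<open>N = k - 1\<close>. For fixed \<open>t\<close> these are the Poisson weights in
  \<open>N\<close>, whence the bound by 1 below.\<close>

definition gamma_density :: "nat \<Rightarrow> real \<Rightarrow> real" where
  "gamma_density N t = t ^ N * exp (- t) / fact N"

lemma gamma_density_nonneg: "t \<ge> 0 \<Longrightarrow> gamma_density N t \<ge> 0"
  by (simp add: gamma_density_def)

lemma power_div_fact_le_exp: "t \<ge> 0 \<Longrightarrow> t ^ N / fact N \<le> exp (t::real)"
proof -
  assume t: "t \<ge> 0"
  have "(\<Sum>n\<in>{N}. inverse (fact n) * t ^ n) \<le> (\<Sum>n. inverse (fact n) * t ^ n)"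
    using t by (intro sum_le_suminf summable_exp) auto
  thus ?thesis by (simp add: exp_def scaleR_conv_of_real field_simps)
qed

lemma gamma_density_le_1: "t \<ge> 0 \<Longrightarrow> gamma_density N t \<le> 1"
  using power_div_fact_le_exp[of t N] by (simp add: gamma_density_def exp_minus field_simps)

lemma gamma_density_shift:
  assumes "N > 0" "t > 0"
  shows "gamma_density N t = gamma_density N (real N) * exp (real N * ln (t / real N) - (t - real N))"
proof -
  have "exp (real N * ln (t / real N)) = (t / real N) ^ N"
    using assms by (simp add: exp_of_nat_mult)
  hence "exp (real N * ln (t / real N) - (t - real N)) = (t / real N) ^ N * exp (real N) * exp (- t)"
    by (simp add: diff_diff_eq2 exp_diff exp_add exp_minus divide_inverse)
  thus ?thesis using assms by (simp add: gamma_density_def power_divide exp_minus)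
qed

text \<open>For \<open>x \<ge> 1\<close> this is the trapezoidal bound for the convex function
  \<open>1 / t\<close>; for \<open>x < 1\<close> the stronger bound with denominator 2 holds, since
  the derivative of the difference is \<open>(1 - t) ^ 2 / t\<close>. The common denominator covers
  small and large deviations in one formula.\<close>

lemma ln_le_sub_quadratic:
  fixes x :: real
  assumes "x > 0"
  shows "ln x \<le> (x - 1) - (x - 1) ^ 2 / (2 * (1 + \<bar>x - 1\<bar>))"
proof (cases "x \<ge> 1")
  case True
  show ?thesis
  proof (cases "x = 1")
    case False
    have "ln (1 + (x - 1)) - ln 1 \<le> (x - 1) * (inverse 1 + inverse (1 + (x - 1))) / 2"
      using True False by (intro ln_inverse_approx_le) auto
    also have "\<dots> = (x - 1) - (x - 1) ^ 2 / (2 * (1 + \<bar>x - 1\<bar>))"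
      using True by (simp add: field_simps power2_eq_square)
    finally show ?thesis by simp
  qed simp
next
  case False
  define f where "f = (\<lambda>x::real. ln x - (x - 1) + (x - 1) ^ 2 / 2)"
  have "f x \<le> f 1"
  proof (rule DERIV_nonneg_imp_nondecreasing[of x 1 f])
    fix t assume t: "x \<le> t" "t \<le> 1"
    hence "t > 0" using assms by linarith
    have "(f has_real_derivative (1 / t - 1 + (t - 1))) (at t)"
      unfolding f_def using \<open>t > 0\<close> by (auto intro!: derivative_eq_intros simp: field_simps)
    moreover have "1 / t - 1 + (t - 1) = (1 - t) ^ 2 / t"
      using \<open>t > 0\<close> by (simp add: field_simps power2_eq_square)
    ultimately show "\<exists>y. (f has_real_derivative y) (at t) \<and> y \<ge> 0"
      using \<open>t > 0\<close> by (auto intro!: exI[of _ "(1 - t) ^ 2 / t"])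
  qed (use False in auto)
  hence "ln x \<le> (x - 1) - (x - 1) ^ 2 / 2" by (simp add: f_def)
  also have "(x - 1) ^ 2 / (2 * (1 + \<bar>x - 1\<bar>)) \<le> (x - 1) ^ 2 / 2"
    by (intro divide_left_mono) (auto intro!: add_pos_nonneg)
  hence "(x - 1) - (x - 1) ^ 2 / 2 \<le> (x - 1) - (x - 1) ^ 2 / (2 * (1 + \<bar>x - 1\<bar>))" by simp
  finally show ?thesis .
qed

text \<open>The value at the mode is estimated by 1. The exponent is of Gaussian type with variance
  about \<open>N\<close> while \<open>\<bar>t - N\<bar>\<close> is at most \<open>N\<close>, and
  grows linearly beyond; both ranges are used.\<close>

lemma gamma_density_le_exp:
  assumes "N > 0" "t > 0"
  shows "gamma_density N t \<le> exp (- ((t - real N) ^ 2 / (2 * (real N + \<bar>t - real N\<bar>))))"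
proof -
  define h where "h = t - real N"
  have d: "t / real N - 1 = h / real N" using assms by (simp add: h_def field_simps)
  have "real N * ln (t / real N) \<le> real N * (h / real N - (h / real N) ^ 2 / (2 * (1 + \<bar>h / real N\<bar>)))"
    using ln_le_sub_quadratic[of "t / real N"] assms unfolding d by (intro mult_left_mono) auto
  also have "\<dots> = h - h ^ 2 / (2 * (real N + \<bar>h\<bar>))"
  proof -
    have "1 + \<bar>h / real N\<bar> = (real N + \<bar>h\<bar>) / real N" using assms by (simp add: field_simps)
    thus ?thesis using assms by (simp add: right_diff_distrib power_divide power2_eq_square)
  qed
  finally have "real N * ln (t / real N) - (t - real N) \<le> - (h ^ 2 / (2 * (real N + \<bar>h\<bar>)))"
    by (simp add: h_def)
  hence "gamma_density N t \<le> 1 * exp (- (h ^ 2 / (2 * (real N + \<bar>h\<bar>))))"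
    unfolding gamma_density_shift[OF assms]
    by (intro mult_mono gamma_density_le_1) auto
  thus ?thesis by (simp add: h_def)
qed

text \<open>Within one standard deviation of the mode the second order term costs at most
  \<open>exp (-2)\<close>, and Stirling's bound at the mode costs \<open>exp (-1)\<close>. The
  condition \<open>N \<ge> 4\<close> keeps the relative deviation \<open>d\<close> below
  \<open>1 / 2\<close>.\<close>

lemma gamma_density_ge:
  assumes N: "N \<ge> 4" and t: "\<bar>t - real N\<bar> \<le> sqrt (real N)"
  shows "gamma_density N t \<ge> exp (-3) / sqrt (real N)"
proof -
  have sq: "sqrt (real N) \<le> real N / 2"
  proof (rule real_le_lsqrt)
    show "real N \<le> (real N / 2) ^ 2" using N by (simp add: power2_eq_square field_simps)
  qed auto
  define d where "d = (t - real N) / real N"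
  have d: "\<bar>d\<bar> \<le> 1 / 2" using t sq N by (auto simp: d_def field_simps)
  have t0: "t > 0" using t sq N by linarith
  have "t / real N = 1 + d" using N by (simp add: d_def field_simps)
  moreover have "ln (1 + d) \<ge> d - 2 * d ^ 2"
    using abs_ln_one_plus_x_minus_x_bound[OF d] by linarith
  ultimately have "real N * (d - 2 * d ^ 2) \<le> real N * ln (t / real N)"
    by (intro mult_left_mono) auto
  moreover have "real N * d = t - real N" using N by (simp add: d_def)
  moreover have "real N * d ^ 2 \<le> 1"
  proof -
    have "\<bar>t - real N\<bar> ^ 2 \<le> sqrt (real N) ^ 2" using t by (intro power_mono) auto
    moreover have "real N * d ^ 2 = (t - real N) ^ 2 / real N"
      using N by (simp add: d_def power2_eq_square)
    ultimately show ?thesis using N by simp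
  qed
  ultimately have e: "- 2 \<le> real N * ln (t / real N) - (t - real N)"
    by (simp add: algebra_simps)
  have "gamma_density N (real N) \<ge> exp (-1) / sqrt (real N)"
  proof -
    have "gamma_density N (real N) = (real N / exp 1) ^ N / fact N"
      using exp_of_nat_mult[of N "-1::real"] by (simp add: gamma_density_def power_divide exp_minus field_simps)
    also have "\<dots> \<ge> (real N / exp 1) ^ N / (exp 1 * sqrt (real N) * (real N / exp 1) ^ N)"
      using N by (intro divide_left_mono fact_le_Stirling) auto
    also have "(real N / exp 1) ^ N / (exp 1 * sqrt (real N) * (real N / exp 1) ^ N) = exp (-1) / sqrt (real N)"
      using N by (simp add: exp_minus field_simps)
    finally show ?thesis .
  qed
  hence "exp (-1) / sqrt (real N) * exp (-2) \<le>
      gamma_density N (real N) * exp (real N * ln (t / real N) - (t - real N))"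
    using e by (intro mult_mono) (auto intro: gamma_density_nonneg)
  also have "\<dots> = gamma_density N t"
    using N t0 by (simp add: gamma_density_shift[of N t])
  finally show ?thesis by (simp flip: exp_add)
qed

section \<open>Matrices with nonzero lower left entry\<close>

lemma fund_domain_Im_bound:
  assumes "z \<in> fund_domain"
  shows "Im z > 0" "3 / 4 \<le> Im z ^ 2"
proof -
  show "Im z > 0" using assms by (simp add: fund_domain_def upper_half_plane_def)
  have "1 ^ 2 \<le> norm z ^ 2" using assms by (intro power_mono) (auto simp: fund_domain_def)
  moreover have "\<bar>Re z\<bar> ^ 2 \<le> (1 / 2) ^ 2"
    using assms by (intro power_mono) (auto simp: fund_domain_def)
  ultimately show "3 / 4 \<le> Im z ^ 2" unfolding cmod_power2 by (simp add: power_divide)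
qed

text \<open>From \<open>c * \<gamma>z = a - 1 / (c * z + d)\<close> one gets
  \<open>c * (\<gamma>z - cnj z) = a + v\<close>, where \<open>v\<close> depends only on
  \<open>c\<close>, \<open>d\<close> and \<open>z\<close>. So \<open>a\<close> enters as an integer
  shift, over which one can sum for fixed \<open>c\<close> and \<open>d\<close>.\<close>

lemma b_fun_diag_norm:
  assumes g: "\<gamma> \<in> SL2Z" and y: "Im z > 0" and c: "\<gamma> $ 2 $ 1 \<noteq> 0"
  defines "r \<equiv> norm (moebius_den \<gamma> z)"
  defines "v \<equiv> - of_int (\<gamma> $ 2 $ 1) * cnj z - 1 / moebius_den \<gamma> z"
  shows "Im z * norm (b_fun \<gamma> z (- cnj z)) =
           2 * Im z * \<bar>of_int (\<gamma> $ 2 $ 1)\<bar> / (norm (of_int (\<gamma> $ 1 $ 1) + v) * r)"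
    and "Im v = of_int (\<gamma> $ 2 $ 1) * Im z * (1 + 1 / r ^ 2)"
proof -
  define a b c d where "a = \<gamma> $ 1 $ 1" and "b = \<gamma> $ 1 $ 2" and "c = \<gamma> $ 2 $ 1" and "d = \<gamma> $ 2 $ 2"
  have c0: "c \<noteq> 0" using assms by (simp add: c_def)
  define D where "D = moebius_den \<gamma> z"
  have D: "D \<noteq> 0" unfolding D_def by (rule moebius_den_nonzero[OF g y])
  have "a * d - b * c = 1"
    using g by (simp add: SL2Z_def det_2 a_def b_def c_def d_def)
  hence det: "of_int a * of_int d - of_int b * of_int c = (1::complex)"
    by (metis of_int_1 of_int_diff of_int_mult)
  have eq: "of_int c * (- cnj z + moebius_act \<gamma> z) = of_int a + v"
  proof -
    have "of_int c * (of_int a * z + of_int b) = of_int a * D - 1"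
      using det by (simp add: D_def moebius_den_def a_def b_def c_def d_def algebra_simps)
    hence "of_int c * moebius_act \<gamma> z = (of_int a * D - 1) / D"
      by (simp add: moebius_act_def a_def b_def c_def d_def D_def)
    thus ?thesis using D by (simp add: v_def c_def D_def[symmetric] field_simps)
  qed
  have "norm (b_fun \<gamma> z (- cnj z)) = 2 / (norm (- cnj z + moebius_act \<gamma> z) * r)"
    by (simp add: b_fun_def norm_divide norm_mult r_def)
  also have "norm (- cnj z + moebius_act \<gamma> z) = norm (of_int a + v) / \<bar>of_int c\<bar>"
    unfolding eq[symmetric] using c0 by (simp add: norm_mult)
  finally show "Im z * norm (b_fun \<gamma> z (- cnj z)) =
           2 * Im z * \<bar>of_int (\<gamma> $ 2 $ 1)\<bar> / (norm (of_int (\<gamma> $ 1 $ 1) + v) * r)"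
    by (simp add: a_def c_def)
  have "Im (1 / D) = - Im D / r ^ 2"
    by (simp add: Im_divide r_def D_def cmod_power2)
  also have "Im D = of_int c * Im z" by (simp add: D_def moebius_den_def c_def)
  finally show "Im v = of_int (\<gamma> $ 2 $ 1) * Im z * (1 + 1 / r ^ 2)"
    by (simp add: v_def c_def D_def algebra_simps)
qed

lemma moebius_den_norm_sq:
  "norm (moebius_den \<gamma> z) ^ 2 =
     (of_int (\<gamma> $ 2 $ 2) + of_int (\<gamma> $ 2 $ 1) * Re z) ^ 2 + (of_int (\<gamma> $ 2 $ 1) * Im z) ^ 2"
  by (simp add: cmod_power2 moebius_den_def add.commute)

text \<open>Dropping the real part of \<open>a + v\<close> leaves
  \<open>\<bar>c\<bar> * y * (1 + 1 / r^2)\<close>, whose first two factors cancel. The second claim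
  is \<open>\<bar>Im (c * z + d)\<bar> = \<bar>c\<bar> * y \<ge> y\<close>.\<close>

lemma b_fun_diag_le:
  assumes g: "\<gamma> \<in> SL2Z" and y: "Im z > 0" and c: "\<gamma> $ 2 $ 1 \<noteq> 0"
  defines "r \<equiv> norm (moebius_den \<gamma> z)"
  shows "Im z * norm (b_fun \<gamma> z (- cnj z)) \<le> 2 / (r + 1 / r)" "Im z \<le> r"
proof -
  define v where "v = - of_int (\<gamma> $ 2 $ 1) * cnj z - 1 / moebius_den \<gamma> z"
  define c where "c = \<bar>real_of_int (\<gamma> $ 2 $ 1)\<bar>"
  have c0: "c \<ge> 1" using assms unfolding c_def by linarith
  have r: "r > 0" using moebius_den_nonzero[OF g y] by (simp add: r_def)
  note N = b_fun_diag_norm[OF g y assms(3), folded r_def v_def c_def]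
  have "\<bar>Im v\<bar> \<le> norm (of_int (\<gamma> $ 1 $ 1) + v)"
    using abs_Im_le_cmod[of "of_int (\<gamma> $ 1 $ 1) + v"] by simp
  also have "\<bar>Im v\<bar> = c * Im z * (1 + 1 / r ^ 2)"
    using y by (simp add: N(2) abs_mult c_def)
  finally have *: "c * Im z * (1 + 1 / r ^ 2) * r \<le> norm (of_int (\<gamma> $ 1 $ 1) + v) * r"
    using r by (intro mult_right_mono) auto
  have pos: "0 < 1 + 1 / r ^ 2" by (intro add_pos_nonneg) auto
  have pos': "0 < c * Im z * (1 + 1 / r ^ 2) * r"
    using c0 r y pos by (intro mult_pos_pos) auto
  have "Im z * norm (b_fun \<gamma> z (- cnj z)) \<le> 2 * Im z * c / (c * Im z * (1 + 1 / r ^ 2) * r)"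
    unfolding N(1) using c0 y
    by (intro divide_left_mono * mult_pos_pos[OF less_le_trans[OF pos' *] pos']) auto
  also have "\<dots> = 2 / ((1 + 1 / r ^ 2) * r)" using c0 y by simp
  also have "(1 + 1 / r ^ 2) * r = r + 1 / r" using r by (simp add: field_simps power2_eq_square)
  finally show "Im z * norm (b_fun \<gamma> z (- cnj z)) \<le> 2 / (r + 1 / r)" .
  have "Im z \<le> c * Im z" using c0 y by simp
  also have "\<dots> = \<bar>Im (moebius_den \<gamma> z)\<bar>"
    using y by (simp add: moebius_den_def c_def abs_mult)
  also have "\<dots> \<le> r" unfolding r_def by (rule abs_Im_le_cmod)
  finally show "Im z \<le> r" .
qed

lemma b_fun_diag_le_1:
  assumes "\<gamma> \<in> SL2Z" "Im z > 0" "\<gamma> $ 2 $ 1 \<noteq> 0"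
  shows "Im z * norm (b_fun \<gamma> z (- cnj z)) \<le> 1"
proof -
  define r where "r = norm (moebius_den \<gamma> z)"
  have r: "r > 0" using moebius_den_nonzero[OF assms(1,2)] by (simp add: r_def)
  have "0 \<le> (r - 1) ^ 2 / r" using r by simp
  also have "\<dots> = r + 1 / r - 2" using r by (simp add: field_simps power2_eq_square)
  finally have "2 / (r + 1 / r) \<le> 1" using r by simp
  thus ?thesis using b_fun_diag_le(1)[OF assms] unfolding r_def by linarith
qed

text \<open>Here \<open>r \<ge> y \<ge> 2\<close>, and on that range \<open>r + 1 / r\<close> is
  smallest at \<open>r = 2\<close>, with value \<open>5 / 2\<close>.\<close>

lemma b_fun_diag_le_four_fifths:
  assumes "\<gamma> \<in> SL2Z" "Im z \<ge> 2" "\<gamma> $ 2 $ 1 \<noteq> 0"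
  shows "Im z * norm (b_fun \<gamma> z (- cnj z)) \<le> 4 / 5"
proof -
  have y: "Im z > 0" using assms by simp
  define r where "r = norm (moebius_den \<gamma> z)"
  have r: "r \<ge> 2" using b_fun_diag_le(2)[OF assms(1) y assms(3)] assms by (simp add: r_def)
  have "0 \<le> (r - 2) * (r - 1 / 2) / r" using r by simp
  also have "\<dots> = r + 1 / r - 5 / 2" using r by (simp add: field_simps)
  finally have "2 / (r + 1 / r) \<le> 2 / (5 / 2)" using r by (intro divide_left_mono) auto
  thus ?thesis using b_fun_diag_le(1)[OF assms(1) y assms(3)] unfolding r_def by simp
qed

text \<open>The fourth power is \<open>16 * (c * y)^4 / (s^4 * r^4)\<close>. Since
  \<open>s^2 \<ge> u \<ge> (c * y)^2\<close> and \<open>r^2 \<ge> (c * y)^2\<close>, half of the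
  denominator cancels the numerator; what remains is one inverse square for the sum over
  \<open>d\<close> and one for the sum over \<open>a\<close>.\<close>

lemma b_fun_diag_power4_le:
  assumes g: "\<gamma> \<in> SL2Z" and y: "Im z > 0" and c: "\<gamma> $ 2 $ 1 \<noteq> 0"
  shows "(Im z * norm (b_fun \<gamma> z (- cnj z))) ^ 4 \<le>
    16 * (1 / ((of_int (\<gamma> $ 2 $ 2) + of_int (\<gamma> $ 2 $ 1) * Re z) ^ 2 + (of_int (\<gamma> $ 2 $ 1) * Im z) ^ 2)) *
      (1 / ((of_int (\<gamma> $ 1 $ 1) + Re (- of_int (\<gamma> $ 2 $ 1) * cnj z -
           1 / (of_int (\<gamma> $ 2 $ 1) * z + of_int (\<gamma> $ 2 $ 2)))) ^ 2 + (of_int (\<gamma> $ 2 $ 1) * Im z) ^ 2))"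
proof -
  define v where "v = - of_int (\<gamma> $ 2 $ 1) * cnj z - 1 / moebius_den \<gamma> z"
  define r where "r = norm (moebius_den \<gamma> z)"
  define c where "c = real_of_int (\<gamma> $ 2 $ 1)"
  define s where "s = norm (of_int (\<gamma> $ 1 $ 1) + v)"
  define u where "u = (of_int (\<gamma> $ 1 $ 1) + Re v) ^ 2 + (c * Im z) ^ 2"
  have c0: "c \<noteq> 0" using assms unfolding c_def by simp
  have r: "r > 0" using moebius_den_nonzero[OF g y] by (simp add: r_def)
  note N = b_fun_diag_norm[OF g y assms(3), folded r_def v_def c_def s_def]
  have pos: "(c * Im z) ^ 2 > 0" using c0 y by simp
  have "\<bar>c * Im z\<bar> * 1 \<le> \<bar>c * Im z\<bar> * (1 + 1 / r ^ 2)" by (intro mult_left_mono) auto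
  also have "\<dots> = \<bar>Im v\<bar>" unfolding N(2) using r by (simp add: abs_mult)
  finally have "\<bar>c * Im z\<bar> ^ 2 \<le> \<bar>Im v\<bar> ^ 2" by (intro power_mono) auto
  hence us: "u \<le> s ^ 2" unfolding s_def norm_of_int_add_sq u_def by simp
  have ru: "(c * Im z) ^ 2 \<le> r ^ 2" unfolding r_def moebius_den_norm_sq c_def by simp
  have u0: "u \<ge> (c * Im z) ^ 2" by (simp add: u_def)
  hence u1: "u > 0" "s ^ 2 > 0" using pos us by linarith+
  hence s0: "s \<noteq> 0" by auto
  have "(Im z * norm (b_fun \<gamma> z (- cnj z))) ^ 4 = 16 * ((c * Im z) ^ 2 * (c * Im z) ^ 2) / ((s ^ 2 * s ^ 2) * (r ^ 2 * r ^ 2))"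
    unfolding N(1) by (simp add: power_divide power_mult_distrib power2_eq_square power4_eq_xxxx mult_ac)
  also have "\<dots> \<le> 16 * ((c * Im z) ^ 2 * (c * Im z) ^ 2) / (((c * Im z) ^ 2 * u) * ((c * Im z) ^ 2 * r ^ 2))"
    using us ru u0 pos r
    by (intro divide_left_mono mult_mono mult_pos_pos) (simp_all add: u1 s0 less_imp_le)
  also have "\<dots> = 16 * (1 / r ^ 2) * (1 / u)" using c0 y by (simp add: field_simps)
  finally show ?thesis
    unfolding r_def u_def c_def v_def moebius_den_norm_sq unfolding moebius_den_def .
qed

text \<open>
  Since \<open>b = (a d - 1) / c\<close>, the sum may be extended to all triples \<open>(a, c, d)\<close> with \<open>c \<noteq> 0\<close>.
  Ignoring the divisibility condition loses a factor \<open>c\<close>, which the convergence can afford.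
\<close>

lemma sum_nonparabolic_le:
  assumes z: "z \<in> fund_domain" and F: "finite F" "F \<subseteq> {\<gamma> \<in> SL2Z. \<gamma> $ 2 $ 1 \<noteq> 0}"
  shows "(\<Sum>\<gamma>\<in>F. (Im z * norm (b_fun \<gamma> z (- cnj z))) ^ 4) \<le> 10000"
proof -
  note y = fund_domain_Im_bound[OF z]
  define A C D where "A = (\<lambda>\<gamma>::int^2^2. \<gamma> $ 1 $ 1) ` F" and "C = (\<lambda>\<gamma>::int^2^2. \<gamma> $ 2 $ 1) ` F"
    and "D = (\<lambda>\<gamma>::int^2^2. \<gamma> $ 2 $ 2) ` F"
  have fin: "finite A" "finite C" "finite D" using F by (auto simp: A_def C_def D_def)
  define p where "p = (\<lambda>c d::int. 1 / ((of_int d + of_int c * Re z) ^ 2 + (of_int c * Im z) ^ 2))"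
  define q where "q = (\<lambda>c d a::int. 1 / ((of_int a + Re (- of_int c * cnj z -
           1 / (of_int c * z + of_int d))) ^ 2 + (of_int c * Im z) ^ 2))"
  define h where "h = (\<lambda>\<gamma>::int^2^2. (\<gamma> $ 2 $ 1, \<gamma> $ 2 $ 2, \<gamma> $ 1 $ 1))"
  have inj: "inj_on h F"
  proof (rule inj_onI)
    fix \<gamma> \<delta> assume *: "\<gamma> \<in> F" "\<delta> \<in> F" "h \<gamma> = h \<delta>"
    have "\<gamma> $ 1 $ 1 * \<gamma> $ 2 $ 2 - \<gamma> $ 1 $ 2 * \<gamma> $ 2 $ 1 = 1"
      "\<delta> $ 1 $ 1 * \<delta> $ 2 $ 2 - \<delta> $ 1 $ 2 * \<delta> $ 2 $ 1 = 1" "\<gamma> $ 2 $ 1 \<noteq> 0"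
      using * F by (auto simp: SL2Z_def det_2)
    moreover from this have "(\<gamma> $ 1 $ 2 - \<delta> $ 1 $ 2) * \<gamma> $ 2 $ 1 = 0"
      using * by (simp add: h_def algebra_simps)
    ultimately have "\<gamma> $ 1 $ 2 = \<delta> $ 1 $ 2" by simp
    thus "\<gamma> = \<delta>" using * by (simp add: vec_eq_iff forall_2 h_def)
  qed
  \<comment> \<open>From \<open>Im z ^ 2 \<ge> 3 / 4\<close> one gets
    \<open>\<bar>c * Im z\<bar> \<ge> 5 / 6\<close>, which turns the first summand into
    \<open>12 / 5\<close> over the same denominator; \<open>12 / 5 + pi < 6\<close>.\<close>
  have bound: "2 / (of_int c * Im z) ^ 2 + pi / \<bar>of_int c * Im z\<bar> \<le> 6 / \<bar>of_int c * Im z\<bar>"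
    if "c \<noteq> 0" for c :: int
  proof -
    define t where "t = \<bar>of_int c * Im z\<bar>"
    have "(5 / 6) ^ 2 \<le> Im z ^ 2" using y by (simp add: power2_eq_square)
    hence "5 / 6 \<le> Im z" using y by (intro power2_le_imp_le[of "5/6"]) auto
    moreover have "\<bar>real_of_int c\<bar> \<ge> 1" using that by linarith
    ultimately have "1 * (5 / 6) \<le> \<bar>real_of_int c\<bar> * Im z" by (intro mult_mono) auto
    hence t: "t \<ge> 5 / 6" using y by (simp add: t_def abs_mult)
    have "2 / t ^ 2 = 2 / t / t" by (simp add: power2_eq_square)
    also have "\<dots> \<le> (12 / 5) / t" using t by (intro divide_right_mono) (auto simp: field_simps)
    finally have "2 / t ^ 2 + pi / t \<le> (12 / 5 + pi) / t" by (simp add: add_divide_distrib)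
    also have "\<dots> \<le> 6 / t" using t pi_less_4 pi_approx by (intro divide_right_mono) auto
    finally show ?thesis by (simp add: t_def)
  qed
  have C0: "c \<noteq> 0" if "c \<in> C" for c using that F by (auto simp: C_def)
  have line: "(\<Sum>n\<in>G. 1 / ((of_int n + X) ^ 2 + (of_int c * Im z) ^ 2)) \<le> 6 / \<bar>of_int c * Im z\<bar>"
    if "c \<in> C" "finite G" for c X and G :: "int set"
  proof -
    have "(\<Sum>n\<in>G. 1 / ((of_int n + X) ^ 2 + \<bar>of_int c * Im z\<bar> ^ 2)) \<le>
        2 / \<bar>of_int c * Im z\<bar> ^ 2 + pi / \<bar>of_int c * Im z\<bar>"
      using C0[of c] that y by (intro sum_int_inverse_square_add_le) auto
    thus ?thesis using bound[OF C0[OF that(1)]] by simp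
  qed
  have sq: "(\<Sum>a\<in>A. q c d a) \<le> 6 / \<bar>of_int c * Im z\<bar>" if "c \<in> C" for c d
    unfolding q_def by (rule line[OF that fin(1)])
  have sp: "(\<Sum>d\<in>D. p c d) \<le> 6 / \<bar>of_int c * Im z\<bar>" if "c \<in> C" for c
    unfolding p_def by (rule line[OF that fin(3)])
  have pq0: "p c d \<ge> 0" "q c d a \<ge> 0" for c d a by (auto simp: p_def q_def)
  have "(\<Sum>\<gamma>\<in>F. (Im z * norm (b_fun \<gamma> z (- cnj z))) ^ 4) \<le>
      (\<Sum>\<gamma>\<in>F. (\<lambda>(c, d, a). 16 * p c d * q c d a) (h \<gamma>))"
    using F y b_fun_diag_power4_le[of _ z] by (intro sum_mono) (auto simp: h_def p_def q_def)
  also have "\<dots> = (\<Sum>(c, d, a)\<in>h ` F. 16 * p c d * q c d a)"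
    using inj by (simp add: sum.reindex)
  also have "\<dots> \<le> (\<Sum>(c, d, a)\<in>C \<times> D \<times> A. 16 * p c d * q c d a)"
    using fin pq0 by (intro sum_mono2) (auto simp: h_def A_def C_def D_def)
  also have "\<dots> = (\<Sum>c\<in>C. \<Sum>d\<in>D. 16 * p c d * (\<Sum>a\<in>A. q c d a))"
    by (simp add: sum.cartesian_product[symmetric] sum_distrib_left)
  also have "\<dots> \<le> (\<Sum>c\<in>C. \<Sum>d\<in>D. 16 * p c d * (6 / \<bar>of_int c * Im z\<bar>))"
    using pq0 by (intro sum_mono mult_left_mono sq) auto
  also have "\<dots> = (\<Sum>c\<in>C. 96 / \<bar>of_int c * Im z\<bar> * (\<Sum>d\<in>D. p c d))"
    by (simp add: sum_distrib_left sum_distrib_right sum_divide_distrib mult_ac)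
  also have "\<dots> \<le> (\<Sum>c\<in>C. 96 / \<bar>of_int c * Im z\<bar> * (6 / \<bar>of_int c * Im z\<bar>))"
    by (intro sum_mono mult_left_mono sp) auto
  \<comment> \<open>The two line sums give \<open>16 * 6 * 6 = 576\<close> over
    \<open>(c * y)^2\<close>. Now \<open>y^2 \<ge> 3 / 4\<close> and
    \<open>c^2 \<ge> (c^2 + 1) / 2\<close> bring in the factor \<open>8 / 3\<close>, and the sum
    over \<open>c\<close> is at most \<open>2 + pi < 6\<close>.\<close>
  also have "\<dots> \<le> (\<Sum>c\<in>C. 1536 * (1 / ((of_int c + 0) ^ 2 + 1 ^ 2)))"
  proof (rule sum_mono)
    fix c assume "c \<in> C"
    hence "\<bar>real_of_int c\<bar> \<ge> 1" using C0[of c] by linarith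
    hence "\<bar>real_of_int c\<bar> ^ 2 \<ge> 1 ^ 2" by (intro power_mono) auto
    hence c1: "real_of_int c ^ 2 \<ge> 1" by simp
    have "real_of_int c ^ 2 * (3 / 4) \<le> real_of_int c ^ 2 * Im z ^ 2"
      using y by (intro mult_left_mono) auto
    hence le: "3 / 8 * (real_of_int c ^ 2 + 1) \<le> real_of_int c ^ 2 * Im z ^ 2"
      by (rule order.trans[rotated]) (use c1 in simp)
    have "96 / \<bar>of_int c * Im z\<bar> * (6 / \<bar>of_int c * Im z\<bar>) = 576 / (real_of_int c ^ 2 * Im z ^ 2)"
      by (simp add: power_mult_distrib flip: power2_eq_square)
    also have "\<dots> \<le> 576 / (3 / 8 * (real_of_int c ^ 2 + 1))"
      using le y c1 by (intro divide_left_mono mult_pos_pos) auto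
    also have "\<dots> = 1536 * (1 / ((of_int c + 0) ^ 2 + 1 ^ 2))" using c1 by (simp add: field_simps)
    finally show "96 / \<bar>of_int c * Im z\<bar> * (6 / \<bar>of_int c * Im z\<bar>) \<le> 1536 * (1 / ((of_int c + 0) ^ 2 + 1 ^ 2))" .
  qed
  also have "\<dots> \<le> 1536 * (2 / 1 ^ 2 + pi / 1)"
    unfolding sum_distrib_left[symmetric] using fin
    by (intro mult_left_mono sum_int_inverse_square_add_le) auto
  also have "\<dots> \<le> 10000" using pi_less_4 by simp
  finally show ?thesis .
qed

text \<open>Four of the \<open>k\<close> factors secure convergence, the other \<open>k - 4\<close>
  are bounded by \<open>\<rho>\<close> each. It is applied with \<open>\<rho> = 1\<close> and with
  \<open>\<rho> = 4 / 5\<close>.\<close>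

lemma nonparabolic_bound:
  assumes z: "z \<in> fund_domain" and k: "k \<ge> 4" and \<rho>: "0 \<le> \<rho>"
    and le: "\<And>\<gamma>. \<gamma> \<in> SL2Z \<Longrightarrow> \<gamma> $ 2 $ 1 \<noteq> 0 \<Longrightarrow> Im z * norm (b_fun \<gamma> z (- cnj z)) \<le> \<rho>"
  defines "N \<equiv> {\<gamma> \<in> SL2Z. \<gamma> $ 2 $ 1 \<noteq> 0}"
  shows "(\<lambda>\<gamma>. norm ((of_real (Im z) * b_fun \<gamma> z (- cnj z)) ^ k)) summable_on N"
    and "norm (\<Sum>\<^sub>\<infinity>\<gamma>\<in>N. (of_real (Im z) * b_fun \<gamma> z (- cnj z)) ^ k) \<le> 10000 * \<rho> ^ (k - 4)"
proof -
  let ?f = "\<lambda>\<gamma>. (of_real (Im z) * b_fun \<gamma> z (- cnj z)) ^ k"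
  note y = fund_domain_Im_bound[OF z]
  have fin: "(\<Sum>\<gamma>\<in>F. norm (?f \<gamma>)) \<le> 10000 * \<rho> ^ (k - 4)" if F: "finite F" "F \<subseteq> N" for F
  proof -
    have "(\<Sum>\<gamma>\<in>F. norm (?f \<gamma>)) \<le> (\<Sum>\<gamma>\<in>F. \<rho> ^ (k - 4) * (Im z * norm (b_fun \<gamma> z (- cnj z))) ^ 4)"
    proof (rule sum_mono)
      fix \<gamma> assume "\<gamma> \<in> F"
      define Q where "Q = Im z * norm (b_fun \<gamma> z (- cnj z))"
      have Q: "0 \<le> Q" "Q \<le> \<rho>" using y le F \<open>\<gamma> \<in> F\<close> by (auto simp: Q_def N_def)
      have "norm (?f \<gamma>) = Q ^ (k - 4) * Q ^ 4"
        using y k by (simp add: Q_def norm_power norm_mult flip: power_add)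
      also have "\<dots> \<le> \<rho> ^ (k - 4) * Q ^ 4"
        using Q by (intro mult_right_mono power_mono) auto
      finally show "norm (?f \<gamma>) \<le> \<rho> ^ (k - 4) * Q ^ 4" .
    qed
    also have "\<dots> \<le> \<rho> ^ (k - 4) * 10000"
      unfolding sum_distrib_left[symmetric] using F \<rho>
      by (intro mult_left_mono sum_nonparabolic_le[OF z]) (auto simp: N_def)
    finally show ?thesis by simp
  qed
  show summ: "(\<lambda>\<gamma>. norm (?f \<gamma>)) summable_on N"
    by (rule nonneg_bdd_above_summable_on) (auto intro!: bdd_aboveI2 fin)
  have "norm (infsum ?f N) \<le> infsum (\<lambda>\<gamma>. norm (?f \<gamma>)) N"
    by (rule norm_infsum_bound[OF summ])
  also have "\<dots> \<le> 10000 * \<rho> ^ (k - 4)" by (rule infsum_le_finite_sums[OF summ fin])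
  finally show "norm (infsum ?f N) \<le> 10000 * \<rho> ^ (k - 4)" .
qed

section \<open>Upper triangular matrices\<close>

text \<open>The parameter \<open>s\<close> is a sign. With \<open>s * n\<close> in the corner the
  matrix is \<open>s\<close> times a unipotent one, so both signs act as the translation by
  \<open>n\<close>.\<close>

definition translation :: "int \<Rightarrow> int \<Rightarrow> int^2^2" where
  "translation s n = vector [vector [s, s * n], vector [0, s]]"

lemma translation_nth [simp]:
  "translation s n $ 1 $ 1 = s" "translation s n $ 1 $ 2 = s * n"
  "translation s n $ 2 $ 1 = 0" "translation s n $ 2 $ 2 = s"
  by (simp_all add: translation_def)

lemma b_fun_translation:
  assumes "s = 1 \<or> s = -1"
  shows "b_fun (translation s n) z (- cnj z) = of_int s * (2 * \<i> / (of_int n + 2 * \<i> * of_real (Im z)))"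
proof -
  have "moebius_act (translation s n) z = z + of_int n"
    using assms by (auto simp: moebius_act_def moebius_den_def)
  moreover have "- cnj z + (z + of_int n) = of_int n + 2 * \<i> * of_real (Im z)"
    by (simp add: complex_eq_iff)
  ultimately have "b_fun (translation s n) z (- cnj z) =
      2 * \<i> / (of_int n + 2 * \<i> * of_real (Im z)) * (1 / of_int s)"
    by (simp only: b_fun_def) (simp add: moebius_den_def)
  moreover have "1 / of_int s = (of_int s :: complex)" using assms by auto
  ultimately show ?thesis by (simp only: mult.commute)
qed

lemma parabolic_sum:
  assumes y: "Im z > 0" and k: "k \<ge> 2" "even k"
  defines "P \<equiv> {\<gamma> \<in> SL2Z. \<gamma> $ 2 $ 1 = 0}"
  shows "((\<lambda>\<gamma>. (of_real (Im z) * b_fun \<gamma> z (- cnj z)) ^ k) has_sum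
           2 * (2 * \<i> * of_real (Im z)) ^ k * (\<Sum>\<^sub>\<infinity>n::int. 1 / (of_int n + 2 * \<i> * of_real (Im z)) ^ k)) P"
proof -
  let ?f = "\<lambda>\<gamma>. (of_real (Im z) * b_fun \<gamma> z (- cnj z)) ^ k"
  define w where "w = 2 * \<i> * of_real (Im z)"
  define S where "S = (\<Sum>\<^sub>\<infinity>n::int. 1 / (of_int n + w) ^ k)"
  have "(\<lambda>n::int. norm (1 / (of_int n + w) ^ Suc (k - 1))) summable_on UNIV"
    using y k by (intro abs_summable_inverse_shift_power) (auto simp: w_def)
  hence "(\<lambda>n::int. 1 / (of_int n + w) ^ k) summable_on UNIV"
    using k by (auto intro: abs_summable_summable)
  hence S: "((\<lambda>n::int. w ^ k * (1 / (of_int n + w) ^ k)) has_sum w ^ k * S) UNIV"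
    unfolding S_def by (intro has_sum_cmult_right has_sum_infsum)
  have part: "(?f has_sum w ^ k * S) (range (translation s))" if s: "s = 1 \<or> s = -1" for s
  proof -
    have "bij_betw (translation s) UNIV (range (translation s))"
      using s by (intro inj_on_imp_bij_betw inj_onI) (metis mult_cancel_left translation_nth(2) zero_neq_one zero_neq_neg_one)
    moreover have "?f (translation s n) = w ^ k * (1 / (of_int n + w) ^ k)" for n
    proof -
      have "?f (translation s n) = (of_int s * (w / (of_int n + w))) ^ k"
        by (simp add: b_fun_translation[OF s] w_def mult_ac)
      also have "\<dots> = (w / (of_int n + w)) ^ k"
        using s k by auto
      finally show ?thesis by (simp add: power_divide)
    qed
    ultimately show ?thesis using S by (subst has_sum_reindex_bij_betw[symmetric]) auto
  qed
  have "P = range (translation 1) \<union> range (translation (-1))"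
  proof (intro equalityI subsetI)
    fix \<gamma> assume "\<gamma> \<in> P"
    hence g: "\<gamma> $ 1 $ 1 * \<gamma> $ 2 $ 2 = 1" "\<gamma> $ 2 $ 1 = 0" by (auto simp: P_def SL2Z_def det_2)
    hence "\<gamma> $ 1 $ 1 = 1 \<and> \<gamma> $ 2 $ 2 = 1 \<or> \<gamma> $ 1 $ 1 = -1 \<and> \<gamma> $ 2 $ 2 = -1"
      using zmult_eq_1_iff by blast
    hence "\<gamma> = translation 1 (\<gamma> $ 1 $ 2) \<or> \<gamma> = translation (-1) (- (\<gamma> $ 1 $ 2))"
      using g by (auto simp: vec_eq_iff forall_2)
    thus "\<gamma> \<in> range (translation 1) \<union> range (translation (-1))" by auto
  qed (auto simp: P_def SL2Z_def det_2)
  moreover have "range (translation 1) \<inter> range (translation (-1)) = {}"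
  proof -
    have "translation 1 m \<noteq> translation (-1) n" for m n
      by (metis one_neq_neg_one translation_nth(1))
    thus ?thesis by auto
  qed
  ultimately have "(?f has_sum (w ^ k * S + w ^ k * S)) P"
    using has_sum_Un_disjoint[OF part part] by simp
  thus ?thesis by (simp add: w_def S_def mult.assoc)
qed

section \<open>The parabolic sum as a sum over the Gamma density\<close>

definition gamma_sum :: "nat \<Rightarrow> real \<Rightarrow> real" where
  "gamma_sum N x = (\<Sum>m. x * gamma_density N (x * real m))"

lemma gamma_sum_term:
  "x * gamma_density N (x * real m) = x ^ Suc N / fact N * (real m ^ N * exp (- x) ^ m)"
  using exp_of_nat_mult[of m "- x"]
  by (simp add: gamma_density_def power_mult_distrib mult_ac)

lemma gamma_sum_complex:
  assumes x: "x > 0"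
  shows "summable (\<lambda>m. x * gamma_density N (x * real m))"
    and "of_real (gamma_sum N x) =
           of_real x ^ Suc N / fact N * (\<Sum>m. of_nat m ^ N * exp (- of_real x :: complex) ^ m)"
proof -
  have eq: "(of_nat m ^ N * exp (- of_real x) ^ m :: complex) = of_real (real m ^ N * exp (- x) ^ m)" for m
    by (simp flip: exp_of_real)
  have summ: "summable (\<lambda>m. of_nat m ^ N * exp (- of_real x :: complex) ^ m)"
    using x by (intro summable_power_mult_powser) (simp flip: exp_of_real)
  hence summ': "summable (\<lambda>m. real m ^ N * exp (- x) ^ m)"
    unfolding eq summable_of_real_iff .
  thus "summable (\<lambda>m. x * gamma_density N (x * real m))"
    unfolding gamma_sum_term by (rule summable_mult)
  have "gamma_sum N x = x ^ Suc N / fact N * (\<Sum>m. real m ^ N * exp (- x) ^ m)"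
    unfolding gamma_sum_def gamma_sum_term by (rule suminf_mult[OF summ'])
  thus "of_real (gamma_sum N x) =
      of_real x ^ Suc N / fact N * (\<Sum>m. of_nat m ^ N * exp (- of_real x :: complex) ^ m)"
    unfolding eq suminf_of_real[OF summ', symmetric] by simp
qed

text \<open>The factor \<open>2 * \<i> * y\<close> and the factor \<open>- 2 * pi * \<i>\<close> of
  Lipschitz' formula multiply to the positive number \<open>4 * pi * y\<close>, which is also minus
  the exponent of \<open>q\<close>.\<close>

lemma Lipschitz_gamma_sum:
  assumes y: "y > 0" and N: "N > 0"
  shows "(2 * \<i> * of_real y) ^ Suc N * (\<Sum>\<^sub>\<infinity>n::int. 1 / (of_int n + 2 * \<i> * of_real y) ^ Suc N) =
           of_real (gamma_sum N (4 * pi * y))"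
proof -
  have distrib: "v ^ n * (b ^ n / f * S) = (v * b) ^ n / f * S" for v b f S :: complex and n
    by (simp add: power_mult_distrib)
  have "(2 * \<i> * of_real y) ^ Suc N * (\<Sum>\<^sub>\<infinity>n::int. 1 / (of_int n + 2 * \<i> * of_real y) ^ Suc N) =
     (2 * \<i> * of_real y * (- (2 * of_real pi * \<i>))) ^ Suc N / fact N *
       (\<Sum>m. of_nat m ^ N * exp (2 * of_real pi * \<i> * (2 * \<i> * of_real y)) ^ m)"
    using y N by (subst Lipschitz_summation_formula) (simp_all only: distrib, simp_all)
  also have "2 * of_real pi * \<i> * (2 * \<i> * of_real y) = - of_real (4 * pi * y)"
    by (simp add: complex_eq_iff)
  also have "2 * \<i> * of_real y * (- (2 * of_real pi * \<i>)) = of_real (4 * pi * y)"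
    by (simp add: complex_eq_iff)
  finally show ?thesis using y by (simp add: gamma_sum_complex(2) del: of_real_mult)
qed

text \<open>Bernoulli's inequality \<open>(1 + u) ^ j \<ge> 1 + j * u\<close> with
  \<open>j = k / 2\<close> replaces the power by a Lorentz profile of width about
  \<open>y / sqrt k\<close>, whose sum over the integers is known.\<close>

lemma gamma_sum_le:
  assumes y: "y > 0" and k: "even k" "k \<ge> 2"
  shows "norm (gamma_sum (k - 1) (4 * pi * y)) \<le> 2 + 9 * (y / sqrt (real k))"
proof -
  define w where "w = 2 * \<i> * of_real y"
  obtain j where j: "k = 2 * j" using k by (elim evenE)
  have j0: "j > 0" using j k by auto
  \<comment> \<open>Chosen so that \<open>j * n^2 / (4 * y^2) = n^2 / Y^2\<close>.\<close>
  define Y where "Y = 2 * y / sqrt (real j)"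
  have Y: "Y > 0" using y j0 by (simp add: Y_def)
  have Y2: "Y ^ 2 = 4 * y ^ 2 / real j" using j0 by (simp add: Y_def power_divide power_mult_distrib)
  have S: "Suc (k - 1) = k" using k by simp
  have "of_real (gamma_sum (k - 1) (4 * pi * y)) = w ^ k * (\<Sum>\<^sub>\<infinity>n::int. 1 / (of_int n + w) ^ k)"
    using Lipschitz_gamma_sum[of y "k - 1"] y k unfolding S w_def by simp
  hence "norm (gamma_sum (k - 1) (4 * pi * y)) = norm (w ^ k) * norm (\<Sum>\<^sub>\<infinity>n::int. 1 / (of_int n + w) ^ k)"
    by (metis norm_mult norm_of_real real_norm_def)
  also have "\<dots> \<le> norm (w ^ k) * (\<Sum>\<^sub>\<infinity>n::int. norm (1 / (of_int n + w) ^ k))"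
    using abs_summable_inverse_shift_power[of w "k - 1"] y k unfolding S
    by (intro mult_left_mono norm_infsum_bound) (auto simp: w_def)
  also have "\<dots> = (\<Sum>\<^sub>\<infinity>n::int. norm (w ^ k) * norm (1 / (of_int n + w) ^ k))"
    by (simp add: infsum_cmult_right')
  also have "\<dots> \<le> 2 + pi * Y"
  proof (rule infsum_le_finite_sums)
    show "(\<lambda>n::int. norm (w ^ k) * norm (1 / (of_int n + w) ^ k)) summable_on UNIV"
      using abs_summable_inverse_shift_power[of w "k - 1"] y k unfolding S
      by (intro summable_on_cmult_right) (auto simp: w_def)
    fix F :: "int set" assume F: "finite F"
    have le: "norm (w ^ k) * norm (1 / (of_int n + w) ^ k) \<le> Y ^ 2 * (1 / ((of_int n + 0) ^ 2 + Y ^ 2))" for n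
    proof -
      define u where "u = real_of_int n ^ 2 / (4 * y ^ 2)"
      have u: "u \<ge> 0" by (simp add: u_def)
      have nw: "norm (of_int n + w) ^ 2 = norm w ^ 2 * (1 + u)"
        unfolding norm_of_int_add_sq using y by (simp add: w_def u_def norm_mult field_simps)
      have "norm (of_int n + w) ^ k = norm w ^ k * (1 + u) ^ j"
        unfolding j power_mult nw by (simp add: power_mult_distrib)
      moreover have "norm w > 0" using y by (simp add: w_def)
      ultimately have "norm (w ^ k) * norm (1 / (of_int n + w) ^ k) = 1 / (1 + u) ^ j"
        by (simp add: norm_power norm_divide)
      also have "\<dots> \<le> 1 / (1 + real j * u)"
        using Bernoulli_inequality[of u j] u
        by (intro divide_left_mono mult_pos_pos) (auto intro: add_pos_nonneg)
      also have "real j * u = real_of_int n ^ 2 / Y ^ 2" using j0 y unfolding Y2 u_def by simp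
      also have "1 / (1 + real_of_int n ^ 2 / Y ^ 2) = Y ^ 2 * (1 / ((of_int n + 0) ^ 2 + Y ^ 2))"
        using Y by (simp add: add_divide_eq_iff add.commute)
      finally show ?thesis .
    qed
    have "(\<Sum>n\<in>F. norm (w ^ k) * norm (1 / (of_int n + w) ^ k)) \<le>
        Y ^ 2 * (\<Sum>n\<in>F. 1 / ((of_int n + 0) ^ 2 + Y ^ 2))"
      unfolding sum_distrib_left by (intro sum_mono le)
    also have "\<dots> \<le> Y ^ 2 * (2 / Y ^ 2 + pi / Y)"
      by (intro mult_left_mono sum_int_inverse_square_add_le Y F) auto
    also have "\<dots> = 2 + pi * Y" using Y by (simp add: field_simps power2_eq_square)
    finally show "(\<Sum>n\<in>F. norm (w ^ k) * norm (1 / (of_int n + w) ^ k)) \<le> 2 + pi * Y" .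
  qed
  also have "pi * Y \<le> 9 * (y / sqrt (real k))"
  proof -
    have "Y = 2 * sqrt 2 * (y / sqrt (real k))"
      using j0 by (simp add: Y_def j real_sqrt_mult)
    moreover have "2 * pi * sqrt 2 \<le> 9"
    proof -
      have "sqrt 2 \<le> 1.42" by (rule real_le_lsqrt) (auto simp: power2_eq_square)
      moreover have "pi \<le> 3.15" using pi_approx by simp
      ultimately have "pi * sqrt 2 \<le> 3.15 * 1.42" by (intro mult_mono) auto
      thus ?thesis by simp
    qed
    hence "(2 * pi * sqrt 2) * (y / sqrt (real k)) \<le> 9 * (y / sqrt (real k))"
      using y by (intro mult_right_mono) auto
    ultimately show ?thesis by (simp add: mult_ac)
  qed
  finally show ?thesis by simp
qed

lemma R_ker_diag_decomp:
  assumes z: "z \<in> fund_domain" and k: "even k" "k \<ge> 4"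
  obtains E where "R_ker k z z = of_real (2 * gamma_sum (k - 1) (4 * pi * Im z)) + E"
    "norm E \<le> 10000" "Im z \<ge> 2 \<Longrightarrow> norm E \<le> 30000 * exp (- real k / 5)"
proof -
  note y = fund_domain_Im_bound[OF z]
  define f where "f = (\<lambda>\<gamma>. (of_real (Im z) * b_fun \<gamma> z (- cnj z)) ^ k)"
  define P N where "P = {\<gamma> \<in> SL2Z. \<gamma> $ 2 $ 1 = 0}" and "N = {\<gamma> \<in> SL2Z. \<gamma> $ 2 $ 1 \<noteq> 0}"
  have S: "Suc (k - 1) = k" using k by simp
  have P: "(f has_sum of_real (2 * gamma_sum (k - 1) (4 * pi * Im z))) P"
    using parabolic_sum[OF y(1), of k] Lipschitz_gamma_sum[OF y(1), of "k - 1"] k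
    unfolding S f_def P_def by (simp add: mult.assoc)
  have le1: "Im z * norm (b_fun \<gamma> z (- cnj z)) \<le> 1" if "\<gamma> \<in> SL2Z" "\<gamma> $ 2 $ 1 \<noteq> 0" for \<gamma>
    by (rule b_fun_diag_le_1[OF that(1) y(1) that(2)])
  have bd1: "(\<lambda>\<gamma>. norm (f \<gamma>)) summable_on N"
    unfolding f_def N_def by (rule nonparabolic_bound(1)[OF z k(2) zero_le_one le1])
  have bd2: "norm (infsum f N) \<le> 10000 * 1 ^ (k - 4)"
    unfolding f_def N_def by (rule nonparabolic_bound(2)[OF z k(2) zero_le_one le1])
  have "(f has_sum infsum f N) N"
    using bd1 by (rule has_sum_infsum[OF abs_summable_summable])
  hence "(f has_sum (of_real (2 * gamma_sum (k - 1) (4 * pi * Im z)) + infsum f N)) (P \<union> N)"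
    using P by (intro has_sum_Un_disjoint) (auto simp: P_def N_def)
  moreover have "P \<union> N = SL2Z" by (auto simp: P_def N_def)
  ultimately have "infsum f SL2Z = of_real (2 * gamma_sum (k - 1) (4 * pi * Im z)) + infsum f N"
    by (simp add: infsumI)
  moreover have "R_ker k z z = infsum f SL2Z"
  proof -
    have "(Im z * Im z) ^ (k div 2) = Im z ^ k"
      using k by (metis dvd_mult_div_cancel power2_eq_square power_mult)
    thus ?thesis unfolding R_ker_def f_def
      by (simp add: power_mult_distrib flip: infsum_cmult_right')
  qed
  moreover have "norm (infsum f N) \<le> 10000" using bd2 by simp
  moreover have "norm (infsum f N) \<le> 30000 * exp (- real k / 5)" if "Im z \<ge> 2"
  proof -
    have "norm (infsum f N) \<le> 10000 * (4 / 5) ^ (k - 4)"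
      unfolding f_def N_def using b_fun_diag_le_four_fifths[OF _ that]
      by (intro nonparabolic_bound[OF z k(2)]) auto
    \<comment> \<open>Restores the full exponent at the cost of \<open>(5 / 4) ^ 4 \<le> 3\<close>;
      then \<open>4 / 5 = 1 - 1 / 5 \<le> exp (- 1 / 5)\<close>.\<close>
    also have "(4 / 5 :: real) ^ (k - 4) = (5 / 4) ^ 4 * (4 / 5) ^ k"
      using k power_add[of "4 / 5 :: real" 4 "k - 4"] by (simp add: power_divide)
    also have "\<dots> \<le> 3 * exp (- 1 / 5) ^ k"
      using exp_ge_add_one_self[of "- 1 / 5"] by (intro mult_mono power_mono) (auto simp: power_divide)
    also have "exp (- 1 / 5) ^ k = exp (- real k / 5)" by (simp flip: exp_of_nat_mult)
    finally show ?thesis by simp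
  qed
  ultimately show ?thesis using that by metis
qed

section \<open>Upper bounds away from the mode\<close>

lemma gamma_sum_le_of_bound:
  assumes x: "x \<ge> 1" and N: "N > 0"
    and B: "\<And>m::nat. m \<ge> 1 \<Longrightarrow> (x * real m) ^ 2 * gamma_density N (x * real m) \<le> B"
  shows "gamma_sum N x \<le> 2 * B" "gamma_sum N x \<ge> 0"
proof -
  have summ: "summable (\<lambda>m. x * gamma_density N (x * real m))"
    using x by (intro gamma_sum_complex(1)) auto
  show "gamma_sum N x \<ge> 0" unfolding gamma_sum_def using x
    by (intro suminf_nonneg[OF summ]) (auto intro!: mult_nonneg_nonneg gamma_density_nonneg)
  have "B \<ge> 0" using order.trans[OF _ B[of 1], of 0] x gamma_density_nonneg[of x N] by simp
  \<comment> \<open>The square in the bound \<open>B\<close> pays for the sum over \<open>m\<close>: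
    it leaves \<open>1 / m^2\<close>, with \<open>pi^2 / 6 \<le> 2\<close>. The index shift is
    harmless because the term \<open>m = 0\<close> vanishes for \<open>N > 0\<close>.\<close>
  have basel: "(\<lambda>m. B * (1 / (real (Suc m)) ^ 2)) sums (B * (pi ^ 2 / 6))"
    using inverse_squares_sums by (intro sums_mult) (simp add: add.commute)
  have "gamma_sum N x = (\<Sum>m. x * gamma_density N (x * real (Suc m)))"
    unfolding gamma_sum_def using suminf_split_head[OF summ] N by (simp add: gamma_density_def)
  also have "\<dots> \<le> (\<Sum>m. B * (1 / (real (Suc m)) ^ 2))"
  proof (rule suminf_le)
    fix m
    have "x \<le> x ^ 2" using x by (simp add: power2_eq_square)
    hence "x * gamma_density N (x * real (Suc m)) \<le> x ^ 2 * gamma_density N (x * real (Suc m))"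
      using x by (intro mult_right_mono gamma_density_nonneg) auto
    also have "\<dots> = (x * real (Suc m)) ^ 2 * gamma_density N (x * real (Suc m)) * (1 / (real (Suc m)) ^ 2)"
      by (simp add: power_mult_distrib del: of_nat_Suc)
    also have "\<dots> \<le> B * (1 / (real (Suc m)) ^ 2)"
      by (intro mult_right_mono B) auto
    finally show "x * gamma_density N (x * real (Suc m)) \<le> B * (1 / (real (Suc m)) ^ 2)" .
  next
    show "summable (\<lambda>m. x * gamma_density N (x * real (Suc m)))"
      by (subst summable_Suc_iff) (rule summ)
  qed (use basel in \<open>auto simp only: sums_iff\<close>)
  also have "\<dots> = B * (pi ^ 2 / 6)" using basel by (simp add: sums_iff)
  also have "\<dots> \<le> B * 2"
  proof -
    have "pi \<le> 3.2" using pi_approx by simp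
    hence "pi ^ 2 \<le> 3.2 ^ 2" by (intro power_mono) auto
    thus ?thesis using \<open>B \<ge> 0\<close> by (intro mult_left_mono) (auto simp: power2_eq_square)
  qed
  finally show "gamma_sum N x \<le> 2 * B" by simp
qed

lemma square_mult_exp_neg_le:
  fixes x :: real
  assumes "x \<ge> 0"
  shows "x ^ 2 * exp (- x) \<le> 2"
  using power_div_fact_le_exp[OF assms, of 2] by (simp add: exp_minus field_simps fact_2)

text \<open>The threshold is the distance \<open>sqrt k * ln k / y\<close> scaled by
  \<open>4 * pi * y\<close>. Half of the exponent \<open>\<phi>\<close> supplies
  \<open>exp (- (ln k)^2)\<close>, the other half absorbs the growth of \<open>t^2\<close>.\<close>

lemma gamma_density_far_le:
  assumes k: "k \<ge> 4" and t: "t > 0" and far: "\<bar>t - (real k - 1)\<bar> \<ge> 4 * pi * sqrt (real k) * ln (real k)"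
  shows "t ^ 2 * gamma_density (k - 1) t \<le> 102 * real k ^ 2 * exp (- (ln (real k) ^ 2))"
proof -
  define x where "x = real k"
  define s where "s = sqrt x"
  define l where "l = ln x"
  define L where "L = 4 * pi * s * l"
  define h where "h = \<bar>t - (x - 1)\<bar>"
  define \<phi> where "\<phi> = h ^ 2 / (2 * (x - 1 + h))"
  have x: "x \<ge> 4" using k by (simp add: x_def)
  have s: "s ^ 2 = x" "s \<ge> 2" using x by (auto simp: s_def intro!: real_le_rsqrt)
  have l1: "l \<ge> 1"
  proof -
    have "exp 1 \<le> x" using exp_le x by linarith
    thus ?thesis unfolding l_def using x by (subst ln_ge_iff) auto
  qed
  have l2: "l \<le> 2 * s"
  proof -
    have "l = 2 * ln s" using x by (simp add: l_def s_def ln_sqrt)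
    thus ?thesis using ln_le_minus_one[of s] s by simp
  qed
  have hL: "h \<ge> L" using far by (simp add: h_def L_def x_def l_def s_def)
  have L12: "L \<ge> 12 * s * l"
    unfolding L_def using pi_gt3 s l1 by (intro mult_right_mono) auto
  have "s * l \<ge> 2 * 1" using s l1 by (intro mult_mono) auto
  hence L0: "L > 0" using L12 by simp
  have Lx: "L \<le> 26 * x"
  proof -
    have "L \<le> 4 * pi * s * (2 * s)" unfolding L_def using s l2 by (intro mult_left_mono) auto
    also have "\<dots> = 8 * pi * x" using s by (simp add: power2_eq_square)
    also have "\<dots> \<le> 26 * x" using pi_approx x by (intro mult_right_mono) auto
    finally show ?thesis .
  qed
  \<comment> \<open>The function \<open>h / (x - 1 + h)\<close> increases with \<open>h\<close>, so
    it is estimated at the threshold \<open>L\<close>, where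
    \<open>x - 1 + L \<le> 27 * x\<close>.\<close>
  have frac: "L / (27 * x) \<le> h / (x - 1 + h)"
  proof -
    have "L / (27 * x) \<le> L / (x - 1 + L)"
      using L0 Lx x by (intro divide_left_mono) auto
    also have "\<dots> \<le> h / (x - 1 + h)"
    proof -
      have "0 \<le> (h - L) * (x - 1)" using hL x by simp
      thus ?thesis using L0 hL x by (simp add: divide_simps algebra_simps)
    qed
    finally show ?thesis .
  qed
  have phi: "\<phi> \<ge> h * (L / (27 * x)) / 2"
  proof -
    have "\<phi> = h * (h / (x - 1 + h)) / 2" unfolding \<phi>_def power2_eq_square by (simp only: times_divide_eq_right divide_divide_eq_left mult.commute)
    moreover have "h * (L / (27 * x)) \<le> h * (h / (x - 1 + h))"
      using frac L0 hL by (intro mult_left_mono) auto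
    ultimately show ?thesis by (metis divide_right_mono zero_le_numeral)
  qed
  \<comment> \<open>Both \<open>h\<close> and \<open>L\<close> are at least
    \<open>12 * s * l\<close>, and \<open>144 / 54 \<ge> 2\<close>.\<close>
  have phi1: "\<phi> \<ge> 2 * l ^ 2"
  proof -
    have "(12 * s * l) * (12 * s * l) \<le> h * L" using L12 hL L0 s l1 by (intro mult_mono) auto
    moreover have "(12 * s * l) * (12 * s * l) = 144 * l ^ 2 * x"
      using s by (simp add: power2_eq_square)
    ultimately have le: "144 * l ^ 2 * x / (54 * x) \<le> h * L / (54 * x)"
      using x by (intro divide_right_mono) auto
    have "2 * l ^ 2 \<le> 144 / 54 * l ^ 2" by (intro mult_right_mono) auto
    also have "\<dots> = 144 * l ^ 2 * x / (54 * x)" using x by simp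
    also note le
    also have "h * L / (54 * x) \<le> \<phi>" using phi by simp
    finally show ?thesis .
  qed
  have phi2: "\<phi> \<ge> h / (5 * s)"
  proof -
    have "12 * s * 1 \<le> 12 * s * l" using s l1 by (intro mult_left_mono) auto
    hence "12 * s / (54 * x) \<le> L / (54 * x)" using L12 x by (intro divide_right_mono) auto
    moreover have "12 * s / (54 * x) = 12 / 54 / s" using s by (simp add: power2_eq_square flip: s(1))
    moreover have "1 / 5 / s \<le> 12 / 54 / s" using s by (intro divide_right_mono) auto
    ultimately have "h * (1 / 5 / s) \<le> h * (L / (54 * x))" using hL L0 by (intro mult_left_mono) auto
    thus ?thesis using phi by simp
  qed
  have phi0: "\<phi> \<ge> 0" using phi1 by (smt (verit) zero_le_power2)
  have "gamma_density (k - 1) t \<le> exp (- \<phi>)"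
    using gamma_density_le_exp[of "k - 1" t] k t by (simp add: \<phi>_def h_def x_def of_nat_diff)
  hence "t ^ 2 * gamma_density (k - 1) t \<le> t ^ 2 * exp (- \<phi>)" by (intro mult_left_mono) auto
  also have "\<dots> \<le> (2 * (x ^ 2 + h ^ 2)) * (exp (- \<phi> / 2) * exp (- \<phi> / 2))"
  proof (rule mult_mono)
    have "t \<le> x + h" unfolding h_def by linarith
    hence "t ^ 2 \<le> (x + h) ^ 2" using t by (intro power_mono) auto
    also have "\<dots> \<le> 2 * (x ^ 2 + h ^ 2)"
      using sum_squares_bound[of x h] by (simp add: power2_sum)
    finally show "t ^ 2 \<le> 2 * (x ^ 2 + h ^ 2)" .
  qed (auto simp flip: exp_add)
  also have "\<dots> = 2 * (x ^ 2 * exp (- \<phi> / 2) + h ^ 2 * exp (- \<phi> / 2)) * exp (- \<phi> / 2)"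
    by (simp add: algebra_simps)
  also have "\<dots> \<le> 2 * (x ^ 2 + 50 * x ^ 2) * exp (- (l ^ 2))"
  proof -
    have e1: "x ^ 2 * exp (- \<phi> / 2) \<le> x ^ 2" using phi0 by (intro mult_left_le) auto
    \<comment> \<open>Expressing \<open>h\<close> through \<open>\<phi>\<close> bounds
      \<open>h^2\<close> times half of the decay by a multiple of \<open>x\<close>, and
      \<open>200 * x \<le> 50 * x^2\<close> since \<open>x \<ge> 4\<close>.\<close>
    have "h \<le> 5 * s * \<phi>" using phi2 s by (simp add: field_simps)
    hence "h ^ 2 \<le> (5 * s * \<phi>) ^ 2" using hL L0 by (intro power_mono) auto
    hence "h ^ 2 * exp (- \<phi> / 2) \<le> (5 * s * \<phi>) ^ 2 * exp (- \<phi> / 2)" by (intro mult_right_mono) auto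
    also have "\<dots> = 100 * x * ((\<phi> / 2) ^ 2 * exp (- (\<phi> / 2)))"
      using s by (simp add: power_mult_distrib power_divide)
    also have "\<dots> \<le> 100 * x * 2"
      using x phi0 by (intro mult_left_mono square_mult_exp_neg_le) auto
    also have "\<dots> \<le> 50 * x ^ 2" using x by (simp add: power2_eq_square)
    finally have e2: "h ^ 2 * exp (- \<phi> / 2) \<le> 50 * x ^ 2" .
    have e3: "exp (- \<phi> / 2) \<le> exp (- (l ^ 2))" using phi1 by simp
    show ?thesis
      by (rule mult_mono[OF mult_left_mono[OF add_mono[OF e1 e2]] e3]) auto
  qed
  finally show ?thesis by (simp add: x_def l_def)
qed

text \<open>Beyond twice the mode the exponent is in its linear range and is at least
  \<open>t / 8\<close>; half of it absorbs \<open>t^2\<close>.\<close>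

lemma gamma_density_large_le:
  assumes N: "N > 0" and t: "t \<ge> 2 * real N"
  shows "t ^ 2 * gamma_density N t \<le> 512 * exp (- t / 16)"
proof -
  define h where "h = t - real N"
  have h: "h \<ge> real N" "h > 0" "t / 2 \<le> h" using t N by (auto simp: h_def)
  have "t / 8 \<le> h / 4" using h by simp
  also have "\<dots> = h ^ 2 / (2 * (h + h))" using h by (simp add: power2_eq_square field_simps)
  also have "\<dots> \<le> h ^ 2 / (2 * (real N + h))"
    using h N by (intro divide_left_mono) auto
  finally have "t / 8 \<le> h ^ 2 / (2 * (real N + \<bar>h\<bar>))" using h by simp
  hence "gamma_density N t \<le> exp (- t / 8)"
    using gamma_density_le_exp[of N t] N t by (simp add: h_def order.trans)
  hence "t ^ 2 * gamma_density N t \<le> t ^ 2 * exp (- t / 8)" by (intro mult_left_mono) auto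
  also have "\<dots> = 256 * ((t / 16) ^ 2 * exp (- (t / 16))) * exp (- t / 16)"
    by (simp add: power_divide flip: exp_add)
  also have "\<dots> \<le> 256 * 2 * exp (- t / 16)"
    using t by (intro mult_right_mono mult_left_mono square_mult_exp_neg_le) auto
  finally show ?thesis by simp
qed

section \<open>Lower bounds near the mode\<close>

lemma gamma_sum_ge:
  assumes x: "x > 0" and M: "finite M" and N: "N \<ge> 4"
    and near: "\<And>m. m \<in> M \<Longrightarrow> \<bar>x * real m - real N\<bar> \<le> sqrt (real N)"
  shows "gamma_sum N x \<ge> real (card M) * (x * exp (-3) / sqrt (real N))"
proof -
  have "real (card M) * (x * exp (-3) / sqrt (real N)) = (\<Sum>m\<in>M. x * (exp (-3) / sqrt (real N)))"
    by simp
  also have "\<dots> \<le> (\<Sum>m\<in>M. x * gamma_density N (x * real m))"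
    using x N near by (intro sum_mono mult_left_mono gamma_density_ge) auto
  also have "\<dots> \<le> gamma_sum N x" unfolding gamma_sum_def
    using x M by (intro sum_le_suminf gamma_sum_complex(1)) (auto intro!: mult_nonneg_nonneg gamma_density_nonneg)
  finally show ?thesis .
qed

text \<open>An interval of length \<open>2 * s\<close> around \<open>N\<close> contains at least
  \<open>2 * s / x - 1 \<ge> s / x\<close> multiples of \<open>x\<close>, each contributing
  \<open>x * exp (-3) / s\<close> or more.\<close>

lemma gamma_sum_ge_dense:
  assumes x: "0 < x" "x \<le> sqrt (real N)" and N: "N \<ge> 4"
  shows "gamma_sum N x \<ge> exp (-3)"
proof -
  define s where "s = sqrt (real N)"
  have s: "s > 0" "s * s = real N" using N by (auto simp: s_def)
  have "s \<ge> 1" using N by (simp add: s_def)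
  hence sN: "real N - s \<ge> 0" using mult_left_mono[of 1 s s] s by simp
  define a b where "a = (real N - s) / x" and "b = (real N + s) / x"
  have a: "a \<ge> 0" using sN x by (simp add: a_def)
  have ab: "a \<le> b" using s x by (simp add: a_def b_def divide_right_mono)
  define M where "M = {nat \<lceil>a\<rceil>..nat \<lfloor>b\<rfloor>}"
  have near: "\<bar>x * real m - real N\<bar> \<le> sqrt (real N)" if "m \<in> M" for m
  proof -
    have "a \<le> real m" "real m \<le> b" using that a ab by (auto simp: M_def) linarith+
    thus ?thesis using x by (auto simp: a_def b_def field_simps abs_le_iff s_def)
  qed
  have "b - a - 1 \<le> real (card M)"
  proof -
    have "real (nat \<lceil>a\<rceil>) \<le> a + 1" "real (nat \<lfloor>b\<rfloor>) \<ge> b - 1" using a ab by linarith+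
    thus ?thesis by (simp add: M_def of_nat_diff)
  qed
  moreover have "b - a = 2 * s / x" by (simp add: a_def b_def flip: diff_divide_distrib)
  moreover have "s / x \<ge> 1" using x by (simp add: s_def)
  ultimately have "s / x \<le> real (card M)" by simp
  hence "s / x * (x * exp (-3) / s) \<le> real (card M) * (x * exp (-3) / s)"
    using x s by (intro mult_right_mono) auto
  also have "\<dots> \<le> gamma_sum N x"
    unfolding s_def using near x N by (intro gamma_sum_ge) (auto simp: M_def)
  finally show ?thesis using x s by simp
qed

section \<open>Bounds on the diagonal\<close>

lemma R_ker_diag_le:
  assumes z: "z \<in> fund_domain" and k: "even k" "k \<ge> 4"
  shows "norm (R_ker k z z) \<le> 10004 * (1 + Im z / sqrt (real k))"
proof -
  note y = fund_domain_Im_bound[OF z]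
  obtain E where E: "R_ker k z z = of_real (2 * gamma_sum (k - 1) (4 * pi * Im z)) + E" "norm E \<le> 10000"
    using R_ker_diag_decomp[OF z k] by metis
  have "norm (R_ker k z z) \<le> norm (of_real (2 * gamma_sum (k - 1) (4 * pi * Im z)) :: complex) + norm E"
    unfolding E by (rule norm_triangle_ineq)
  also have "norm (of_real (2 * gamma_sum (k - 1) (4 * pi * Im z)) :: complex) \<le> 4 + 18 * (Im z / sqrt (real k))"
    using gamma_sum_le[OF y(1) k(1)] k unfolding norm_of_real by simp
  also have "4 + 18 * (Im z / sqrt (real k)) + norm E \<le> 10004 + 10004 * (Im z / sqrt (real k))"
  proof -
    have "0 \<le> Im z / sqrt (real k)" using y by simp
    thus ?thesis using E(2) by linarith
  qed
  finally show ?thesis by (simp add: algebra_simps)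
qed

text \<open>The first version covers points with \<open>Im z < 2\<close>, where the matrices with
  \<open>c \<noteq> 0\<close> are controlled by a constant only.\<close>

lemma R_ker_diag_le_of_bound:
  assumes z: "z \<in> fund_domain" and k: "even k" "k \<ge> 4"
    and B: "\<And>m::nat. m \<ge> 1 \<Longrightarrow>
      (4 * pi * Im z * real m) ^ 2 * gamma_density (k - 1) (4 * pi * Im z * real m) \<le> B"
  shows "norm (R_ker k z z) \<le> 4 * B + 10000"
    and "Im z \<ge> 2 \<Longrightarrow> norm (R_ker k z z) \<le> 4 * B + 30000 * exp (- real k / 5)"
proof -
  note y = fund_domain_Im_bound[OF z]
  obtain E where E: "R_ker k z z = of_real (2 * gamma_sum (k - 1) (4 * pi * Im z)) + E" "norm E \<le> 10000"
    "Im z \<ge> 2 \<Longrightarrow> norm E \<le> 30000 * exp (- real k / 5)"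
    using R_ker_diag_decomp[OF z k] by metis
  have "1 / 2 \<le> Im z" by (rule power2_le_imp_le) (use y in \<open>auto simp: power_divide\<close>)
  hence "2 * 3 \<le> 4 * Im z * pi" using pi_gt3 by (intro mult_mono) auto
  hence x: "1 \<le> 4 * pi * Im z" by (simp add: mult_ac)
  have "0 \<le> gamma_sum (k - 1) (4 * pi * Im z)" "gamma_sum (k - 1) (4 * pi * Im z) \<le> 2 * B"
    using k by (intro gamma_sum_le_of_bound[OF x _ B]; simp)+
  hence "norm (of_real (2 * gamma_sum (k - 1) (4 * pi * Im z)) :: complex) \<le> 4 * B"
    unfolding norm_of_real by simp
  hence le: "norm (R_ker k z z) \<le> 4 * B + norm E" unfolding E(1)
    by (rule order.trans[OF norm_triangle_ineq add_right_mono])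
  show "norm (R_ker k z z) \<le> 4 * B + 10000" using le E(2) by linarith
  show "norm (R_ker k z z) \<le> 4 * B + 30000 * exp (- real k / 5)" if "Im z \<ge> 2"
    using le E(3)[OF that] by linarith
qed

text \<open>The decay obtained is \<open>exp (- (ln k)^2)\<close>, which beats every power of
  \<open>k\<close>; the constant depends on \<open>A\<close> through the point where it starts to do
  so.\<close>

lemma R_ker_diag_le_far:
  assumes z: "z \<in> fund_domain" and k: "even k" "k \<ge> 4" and A: "A \<ge> 0"
    and far: "(INF n::int. \<bar>real_of_int n - (real k - 1) / (4 * pi * Im z)\<bar>) > sqrt (real k) * ln (real k) / Im z"
  shows "norm (R_ker k z z) \<le> (408 * exp ((A + 2) ^ 2) + 30000 * exp (5 * A ^ 2)) * real k powr (- A)"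
proof -
  note y = fund_domain_Im_bound[OF z]
  define x where "x = real k"
  have x: "x \<ge> 4" using k by (simp add: x_def)
  have l1: "ln x \<ge> 1"
  proof -
    have "exp 1 \<le> x" using exp_le x by linarith
    thus ?thesis using x by (subst ln_ge_iff) auto
  qed
  have s2: "sqrt x \<ge> 2" using x by (auto intro!: real_le_rsqrt)
  have far': "sqrt x * ln x / Im z < \<bar>real_of_int n - (x - 1) / (4 * pi * Im z)\<bar>" for n
    using far unfolding x_def
    by (rule less_le_trans) (auto intro!: cINF_lower bdd_belowI2[of _ 0])
  \<comment> \<open>Every real number is within \<open>1 / 2\<close> of an integer, so the gap
    exceeding \<open>sqrt x * ln x / Im z\<close> forces
    \<open>Im z > 2 * sqrt x * ln x\<close>.\<close>
  have "Im z \<ge> 2"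
  proof -
    obtain n where "\<bar>of_int n - (x - 1) / (4 * pi * Im z)\<bar> \<le> 1 / 2"
      using of_int_round_abs_le[of "(x - 1) / (4 * pi * Im z)"] by metis
    hence "sqrt x * ln x / Im z < 1 / 2" using far'[of n] by linarith
    hence "2 * (sqrt x * ln x) < Im z" using y by (simp add: field_simps)
    moreover have "2 * 1 \<le> sqrt x * ln x" using s2 l1 x by (intro mult_mono) auto
    ultimately show ?thesis by simp
  qed
  have "norm (R_ker k z z) \<le> 4 * (102 * real k ^ 2 * exp (- (ln (real k) ^ 2))) + 30000 * exp (- real k / 5)"
  proof (rule R_ker_diag_le_of_bound(2)[OF z k _ \<open>Im z \<ge> 2\<close>])
    fix m :: nat assume m: "m \<ge> 1"
    show "(4 * pi * Im z * real m) ^ 2 * gamma_density (k - 1) (4 * pi * Im z * real m) \<le>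
        102 * real k ^ 2 * exp (- (ln (real k) ^ 2))"
    proof (rule gamma_density_far_le[OF k(2)])
      show "4 * pi * Im z * real m > 0" using y m by simp
      have "4 * pi * Im z * (sqrt x * ln x / Im z) \<le>
          4 * pi * Im z * \<bar>real m - (x - 1) / (4 * pi * Im z)\<bar>"
        using far'[of "int m"] y by (intro mult_left_mono) auto
      also have "\<dots> = \<bar>4 * pi * Im z * (real m - (x - 1) / (4 * pi * Im z))\<bar>"
        using y by (simp add: abs_mult)
      also have "4 * pi * Im z * (real m - (x - 1) / (4 * pi * Im z)) = 4 * pi * Im z * real m - (x - 1)"
        using y by (subst right_diff_distrib) simp
      also have "4 * pi * Im z * (sqrt x * ln x / Im z) = 4 * pi * sqrt x * ln x" using y by simp
      finally show "4 * pi * sqrt (real k) * ln (real k) \<le> \<bar>4 * pi * Im z * real m - (real k - 1)\<bar>"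
        by (simp add: x_def)
    qed
  qed
  also have "\<dots> = 408 * (x ^ 2 * exp (- (ln x ^ 2))) + 30000 * exp (- x / 5)" by (simp add: x_def)
  also have "x ^ 2 * exp (- (ln x ^ 2)) \<le> exp ((A + 2) ^ 2) * x powr (- A)"
  proof -
    have "x ^ 2 * exp (- (ln x ^ 2)) = exp (2 * ln x - ln x ^ 2)"
      using x exp_of_nat_mult[of 2 "ln x"] by (simp add: exp_diff exp_minus field_simps)
    also have "\<dots> \<le> exp ((A + 2) ^ 2 - A * ln x)"
    proof (subst exp_le_cancel_iff)
      \<comment> \<open>Completing the square in \<open>ln x\<close>.\<close>
      have "0 \<le> (ln x - (A + 2) / 2) ^ 2 + 3 / 4 * (A + 2) ^ 2" by simp
      also have "\<dots> = (A + 2) ^ 2 - A * ln x - (2 * ln x - ln x ^ 2)"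
        by (simp add: power2_eq_square field_simps)
      finally show "2 * ln x - ln x ^ 2 \<le> (A + 2) ^ 2 - A * ln x" by simp
    qed
    also have "\<dots> = exp ((A + 2) ^ 2) * x powr (- A)"
      using x by (simp add: powr_def exp_diff exp_minus field_simps)
    finally show ?thesis .
  qed
  also have "exp (- x / 5) \<le> exp (5 * A ^ 2) * x powr (- A)"
  proof -
    have "exp (- x / 5) \<le> exp (5 * A ^ 2 - A * ln x)"
    proof (subst exp_le_cancel_iff)
      have "ln x = 2 * ln (sqrt x)" using x by (simp add: ln_sqrt)
      also have "\<dots> \<le> 2 * sqrt x" using ln_le_minus_one[of "sqrt x"] x by simp
      finally have "A * ln x \<le> A * (2 * sqrt x)" using A by (intro mult_left_mono)
      also have "\<dots> \<le> 5 * A ^ 2 + x / 5"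
      proof -
        \<comment> \<open>Together with \<open>ln x \<le> 2 * sqrt x\<close> this trades the power
          of \<open>x\<close> against \<open>x / 5\<close>, which is where the exponent
          \<open>5 * A ^ 2\<close> comes from.\<close>
        have "0 \<le> (5 * A - sqrt x) ^ 2 / 5" by simp
        also have "\<dots> = 5 * A ^ 2 + x / 5 - A * (2 * sqrt x)"
          using x by (simp add: power2_diff power_mult_distrib field_simps)
        finally show ?thesis by simp
      qed
      finally show "- x / 5 \<le> 5 * A ^ 2 - A * ln x" by simp
    qed
    also have "\<dots> = exp (5 * A ^ 2) * x powr (- A)"
      using x by (simp add: powr_def exp_diff exp_minus field_simps)
    finally show ?thesis .
  qed
  finally show ?thesis by (simp add: algebra_simps x_def)
qed

text \<open>Now \<open>4 * pi * y \<ge> 2 * k\<close>, so even the first multiple lies beyond twice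
  the mode. The rates obtained, \<open>1 / 8\<close> and \<open>1 / 5\<close>, are both better than
  \<open>1 / 37\<close>.\<close>

lemma R_ker_diag_le_cusp:
  assumes z: "z \<in> fund_domain" and k: "even k" "k \<ge> 4" and y: "Im z \<ge> real k / (2 * pi)"
  shows "norm (R_ker k z z) \<le> 50000 * exp (- real k / 37)"
proof -
  define B where "B = 512 * exp (- real k / 8)"
  have B: "(4 * pi * Im z * real m) ^ 2 * gamma_density (k - 1) (4 * pi * Im z * real m) \<le> B"
    if "m \<ge> 1" for m :: nat
  proof -
    define t where "t = 4 * pi * Im z * real m"
    have "2 * real k \<le> 4 * pi * Im z" using y by (simp add: field_simps)
    also have "\<dots> \<le> t" unfolding t_def using mult_left_mono[of 1 "real m" "4 * pi * Im z"] that
        fund_domain_Im_bound[OF z] by simp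
    finally have t: "2 * real k \<le> t" .
    have "t ^ 2 * gamma_density (k - 1) t \<le> 512 * exp (- t / 16)"
      using t k by (intro gamma_density_large_le) (auto simp: of_nat_diff)
    also have "\<dots> \<le> B" using t by (simp add: B_def)
    finally show ?thesis by (simp add: t_def)
  qed
  have B': "B \<le> 512 * exp (- real k / 37)" by (simp add: B_def)
  show ?thesis
  proof (cases "Im z \<ge> 2")
    case True
    have "exp (- real k / 5) \<le> exp (- real k / 37)" by simp
    moreover have "exp (- real k / 37) > 0" by simp
    ultimately show ?thesis using R_ker_diag_le_of_bound(2)[OF z k B True] B' by linarith
  next
    case False
    \<comment> \<open>Only finitely many \<open>k\<close> are left, and for them the target is at
      least a third of its constant, which exceeds the bounded error.\<close>
    hence "real k / (2 * pi) < 2" using y by linarith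
    hence "real k < 2 * (2 * pi)" by (simp add: field_simps)
    hence "real k < 37" using pi_less_4 by linarith
    hence "exp (- real k / 37) \<ge> exp (- 1)" by simp
    moreover have "exp (- 1 :: real) \<ge> 1 / 3"
      using exp_le by (simp add: exp_minus field_simps)
    ultimately have "1 / 3 \<le> exp (- real k / 37)" by linarith
    thus ?thesis using R_ker_diag_le_of_bound(1)[OF z k B] B' by linarith
  qed
qed

lemma R_ker_diag_ge:
  assumes z: "z \<in> fund_domain" and k: "even k" "k \<ge> 4" and y: "Im z \<ge> 2"
  shows "Re (R_ker k z z) \<ge> 2 * gamma_sum (k - 1) (4 * pi * Im z) - 30000 * exp (- real k / 5)"
proof -
  obtain E where E: "R_ker k z z = of_real (2 * gamma_sum (k - 1) (4 * pi * Im z)) + E"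
    "Im z \<ge> 2 \<Longrightarrow> norm E \<le> 30000 * exp (- real k / 5)"
    using R_ker_diag_decomp[OF z k] by metis
  have "\<bar>Re E\<bar> \<le> 30000 * exp (- real k / 5)" using abs_Re_le_cmod[of E] E(2)[OF y] by linarith
  thus ?thesis unfolding E(1) by simp
qed

text \<open>The mesh \<open>4 * pi * y\<close> is at most \<open>sqrt k / 3\<close>, hence at most
  \<open>sqrt (k - 1)\<close>, so the dense case applies. Of the resulting
  \<open>2 * exp (-3)\<close> one half pays for the error.\<close>

lemma R_ker_diag_ge_low:
  assumes z: "z \<in> fund_domain" and k: "even k" "k \<ge> 5"
    and y: "Im z \<ge> 2" "Im z \<le> sqrt (real k) / (12 * pi)"
    and K: "30000 * exp (- real k / 5) \<le> exp (-3)"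
  shows "Re (R_ker k z z) \<ge> exp (-3)"
proof -
  have "4 * pi * Im z \<le> sqrt (real k) / 3" using y by (simp add: field_simps)
  also have "\<dots> = sqrt (real k / 9)" by (simp add: real_sqrt_divide)
  also have "\<dots> \<le> sqrt (real (k - 1))" using k by (intro real_sqrt_le_mono) (simp add: of_nat_diff)
  finally have "gamma_sum (k - 1) (4 * pi * Im z) \<ge> exp (-3)"
    using y k by (intro gamma_sum_ge_dense) auto
  thus ?thesis using R_ker_diag_ge[OF z k(1) _ y(1)] k K by simp
qed

text \<open>A single multiple of \<open>4 * pi * y\<close> near the mode suffices. Since
  \<open>y / sqrt k > 1 / (12 * pi)\<close>, its contribution stays above a fixed constant and
  dominates the exponentially small error.\<close>

lemma R_ker_diag_ge_peak:
  assumes z: "z \<in> fund_domain" and k: "even k" "k \<ge> 5"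
    and y: "Im z \<ge> 2" "sqrt (real k) / (12 * pi) < Im z"
    and near: "(INF n\<in>{1::nat..}. \<bar>(real k - 1) / (4 * pi * Im z) - real n\<bar>)
            \<le> sqrt (real k - 1) / (12 * pi * Im z)"
    and K: "30000 * exp (- real k / 5) \<le> exp (-3) / 12"
  shows "Re (R_ker k z z) \<ge> exp (-3) * (Im z / sqrt (real k))"
proof -
  define N where "N = k - 1"
  have N: "real N = real k - 1" "N \<ge> 4" using k by (auto simp: N_def of_nat_diff)
  define r where "r = sqrt (real N) / (12 * pi * Im z)"
  have "r > 0" using N y by (simp add: r_def)
  \<comment> \<open>Rather than showing that the infimum is attained, the radius is doubled: scaled
    by \<open>4 * pi * y\<close> it becomes \<open>2 / 3 * sqrt N\<close>, still within one standard
    deviation.\<close>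
  hence "(INF n\<in>{1::nat..}. \<bar>real N / (4 * pi * Im z) - real n\<bar>) < 2 * r"
    using near unfolding r_def N by linarith
  then obtain n :: nat where n: "\<bar>real N / (4 * pi * Im z) - real n\<bar> < 2 * r"
    by (subst (asm) cINF_less_iff) (auto intro: bdd_belowI2[of _ 0])
  have "\<bar>4 * pi * Im z * real n - real N\<bar> \<le> sqrt (real N)"
  proof -
    have "\<bar>4 * pi * Im z * real n - real N\<bar> = 4 * pi * Im z * \<bar>real N / (4 * pi * Im z) - real n\<bar>"
    proof -
      have "4 * pi * Im z * \<bar>real N / (4 * pi * Im z) - real n\<bar> =
          \<bar>4 * pi * Im z * (real N / (4 * pi * Im z) - real n)\<bar>"
        using y by (simp add: abs_mult)
      also have "4 * pi * Im z * (real N / (4 * pi * Im z) - real n) = real N - 4 * pi * Im z * real n"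
        using y by (simp add: right_diff_distrib)
      finally show ?thesis by (simp add: abs_minus_commute)
    qed
    also have "\<dots> \<le> 4 * pi * Im z * (2 * r)" using n y by (intro mult_left_mono) auto
    also have "\<dots> = 2 / 3 * sqrt (real N)" using y by (simp add: r_def)
    also have "\<dots> \<le> 1 * sqrt (real N)" by (intro mult_right_mono) auto
    finally show ?thesis by simp
  qed
  hence "gamma_sum N (4 * pi * Im z) \<ge> real (card {n}) * (4 * pi * Im z * exp (-3) / sqrt (real N))"
    using y N by (intro gamma_sum_ge) auto
  also have "real (card {n}) * (4 * pi * Im z * exp (-3) / sqrt (real N)) \<ge> 4 * pi * Im z * exp (-3) / sqrt (real k)"
    using y N by (simp add: divide_left_mono)
  finally have g: "gamma_sum N (4 * pi * Im z) \<ge> 4 * pi * (exp (-3) * (Im z / sqrt (real k)))"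
    by (simp add: mult_ac)
  define u where "u = Im z / sqrt (real k)"
  have u: "1 / 12 \<le> pi * u"
    using y k by (simp add: u_def field_simps)
  have u0: "u \<ge> 0" using y by (simp add: u_def)
  define q where "q = pi * (exp (-3) * u)"
  have "exp (-3) * (1 / 12) \<le> exp (-3) * (pi * u)" using u by (intro mult_left_mono) auto
  hence "exp (-3) / 12 \<le> q" by (simp add: q_def mult_ac)
  moreover have "gamma_sum (k - 1) (4 * pi * Im z) \<ge> 4 * q"
    using g by (simp add: N_def u_def q_def)
  moreover have "Re (R_ker k z z) \<ge> 2 * gamma_sum (k - 1) (4 * pi * Im z) - 30000 * exp (- real k / 5)"
    using k by (intro R_ker_diag_ge z y) auto
  moreover have "1 * (exp (-3) * u) \<le> q"
    unfolding q_def using u0 pi_gt3 by (intro mult_right_mono) auto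
  moreover have "q \<ge> 0" using u0 by (simp add: q_def)
  ultimately have "exp (-3) * u \<le> Re (R_ker k z z)" using K by linarith
  thus ?thesis by (simp add: u_def)
qed

theorem theorem3p4:
  shows
    "(\<forall>A\<ge>1::real. \<exists>C>0. \<forall>k z. even k \<longrightarrow> k \<ge> 4 \<longrightarrow> z \<in> fund_domain \<longrightarrow>
        norm (R_ker k z z) \<le> C *
          (if (INF n::int. \<bar>real_of_int n - (real k - 1) / (4 * pi * Im z)\<bar>)
                \<le> sqrt (real k) * ln (real k) / Im z
           then 1 + Im z / sqrt (real k)
           else real k powr (- A)))
   \<and> (\<exists>C>0. \<forall>k z. even k \<longrightarrow> k \<ge> 4 \<longrightarrow> z \<in> fund_domain \<longrightarrow> Im z \<ge> real k / (2 * pi) \<longrightarrow>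
        norm (R_ker k z z) \<le> C * exp (- real k / 37))
   \<and> (\<exists>c>0. \<exists>K. \<forall>k z. even k \<longrightarrow> k \<ge> 4 \<longrightarrow> k \<ge> K \<longrightarrow> z \<in> fund_domain \<longrightarrow>
        (2 \<le> Im z \<and> Im z \<le> sqrt (real k) / (12 * pi) \<longrightarrow>
           Re (R_ker k z z) \<ge> c * 1) \<and>
        (sqrt (real k) / (12 * pi) < Im z \<and> Im z < real k / (2 * pi) \<and>
         (INF n\<in>{1::nat..}. \<bar>(real k - 1) / (4 * pi * Im z) - real n\<bar>)
            \<le> sqrt (real k - 1) / (12 * pi * Im z) \<longrightarrow>
           Re (R_ker k z z) \<ge> c * (Im z / sqrt (real k))))"
proof (intro conjI allI impI)
  fix A :: real assume A: "A \<ge> 1"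
  define D where "D = 408 * exp ((A + 2) ^ 2) + 30000 * exp (5 * A ^ 2)"
  have D: "D > 0" by (simp add: D_def add_pos_pos)
  show "\<exists>C>0. \<forall>k z. even k \<longrightarrow> k \<ge> 4 \<longrightarrow> z \<in> fund_domain \<longrightarrow>
        norm (R_ker k z z) \<le> C *
          (if (INF n::int. \<bar>real_of_int n - (real k - 1) / (4 * pi * Im z)\<bar>)
                \<le> sqrt (real k) * ln (real k) / Im z
           then 1 + Im z / sqrt (real k)
           else real k powr (- A))"
  \<comment> \<open>The sum of the constants of the two branches serves for both, as the right-hand
    side is nonnegative.\<close>
  proof (intro exI[of _ "10004 + D"] conjI allI impI)
    fix k :: nat and z assume k: "even k" "k \<ge> 4" and z: "z \<in> fund_domain"
    let ?X = "if (INF n::int. \<bar>real_of_int n - (real k - 1) / (4 * pi * Im z)\<bar>)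
                \<le> sqrt (real k) * ln (real k) / Im z
           then 1 + Im z / sqrt (real k) else real k powr (- A)"
    have X: "?X \<ge> 0" using fund_domain_Im_bound[OF z] by (auto intro!: add_nonneg_nonneg)
    have "norm (R_ker k z z) \<le> (if (INF n::int. \<bar>real_of_int n - (real k - 1) / (4 * pi * Im z)\<bar>)
                \<le> sqrt (real k) * ln (real k) / Im z then 10004 else D) * ?X"
      using R_ker_diag_le[OF z k] R_ker_diag_le_far[OF z k, of A] A by (auto simp: D_def)
    also have "\<dots> \<le> (10004 + D) * ?X"
      using X D by (intro mult_right_mono) auto
    finally show "norm (R_ker k z z) \<le> (10004 + D) * ?X" .
  qed (use D in auto)
next
  show "\<exists>C>0. \<forall>k z. even k \<longrightarrow> k \<ge> 4 \<longrightarrow> z \<in> fund_domain \<longrightarrow> Im z \<ge> real k / (2 * pi) \<longrightarrow>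
        norm (R_ker k z z) \<le> C * exp (- real k / 37)"
    using R_ker_diag_le_cusp by (intro exI[of _ 50000]) auto
next
  have "((\<lambda>k. 30000 * exp (- real k / 5)) \<longlongrightarrow> 0) at_top" by real_asymp
  hence "eventually (\<lambda>k. 30000 * exp (- real k / 5) < exp (-3) / 12) at_top"
    by (rule order_tendstoD) simp
  then obtain K0 where K0: "\<And>k. k \<ge> K0 \<Longrightarrow> 30000 * exp (- real k / 5) < exp (-3) / 12"
    by (auto simp: eventually_at_top_linorder)
  have K: "30000 * exp (- real k / 5) \<le> exp (-3) / 12" "30000 * exp (- real k / 5) \<le> exp (-3)"
    if "k \<ge> K0" for k
  proof -
    have "0 < exp (-3 :: real)" by simp
    thus "30000 * exp (- real k / 5) \<le> exp (-3) / 12" "30000 * exp (- real k / 5) \<le> exp (-3)"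
      using K0[OF that] by linarith+
  qed
  show "\<exists>c>0. \<exists>K. \<forall>k z. even k \<longrightarrow> k \<ge> 4 \<longrightarrow> k \<ge> K \<longrightarrow> z \<in> fund_domain \<longrightarrow>
        (2 \<le> Im z \<and> Im z \<le> sqrt (real k) / (12 * pi) \<longrightarrow>
           Re (R_ker k z z) \<ge> c * 1) \<and>
        (sqrt (real k) / (12 * pi) < Im z \<and> Im z < real k / (2 * pi) \<and>
         (INF n\<in>{1::nat..}. \<bar>(real k - 1) / (4 * pi * Im z) - real n\<bar>)
            \<le> sqrt (real k - 1) / (12 * pi * Im z) \<longrightarrow>
           Re (R_ker k z z) \<ge> c * (Im z / sqrt (real k)))"
  proof (rule exI[of _ "exp (-3)"], intro conjI, simp,
      rule exI[of _ "max K0 10000"], intro allI impI conjI)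
    fix k :: nat and z assume k: "even k" "k \<ge> 4" "k \<ge> max K0 10000" and z: "z \<in> fund_domain"
    have k': "k \<ge> 5" "k \<ge> K0" using k by auto
    show "Re (R_ker k z z) \<ge> exp (-3) * 1" if "2 \<le> Im z \<and> Im z \<le> sqrt (real k) / (12 * pi)"
      using R_ker_diag_ge_low[OF z k(1) k'(1) _ _ K(2)[OF k'(2)]] that by simp
    assume *: "sqrt (real k) / (12 * pi) < Im z \<and> Im z < real k / (2 * pi) \<and>
         (INF n\<in>{1::nat..}. \<bar>(real k - 1) / (4 * pi * Im z) - real n\<bar>)
            \<le> sqrt (real k - 1) / (12 * pi * Im z)"
    \<comment> \<open>This is the purpose of the threshold 10000: in the second range it yields
      \<open>Im z \<ge> 2\<close>, and with it the exponentially small error.\<close>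
    have "100 \<le> sqrt (real k)" using k by (intro real_le_rsqrt) (auto simp: power2_eq_square)
    hence "24 * pi \<le> sqrt (real k)" using pi_less_4 by linarith
    hence "2 \<le> sqrt (real k) / (12 * pi)" by (simp add: field_simps)
    thus "Re (R_ker k z z) \<ge> exp (-3) * (Im z / sqrt (real k))"
      using * by (intro R_ker_diag_ge_peak[OF z k(1) k'(1) _ _ _ K(1)[OF k'(2)]]) auto
  qed
qed

end
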